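(* Let $\mathcal{F}$ be a finite set of Hadamard promise problems (HPPs), and let $\mathcal{C}$ be the class of HPPs generated from $\mathcal{F}$ by the composition method (notions defined in the context). Let $k_{max}$ be the largest number of gates among the HPPs in $\mathcal{F}$, and set $C:=2(k_{max}-1)$. Then for every problem in $\mathcal{C}$ with $n\ge 2$ black-box gates, there is a causal quantum algorithm that solves it and calls the black-box gates at most $C\cdot n\cdot\log_2(n)$ times.
   Context: Hadamard promise problem (HPP). A set of $n$ black-box unitary gates $U_1,\dots,U_n$ acting on $\mathbb{C}^d$ is given. Fixed products $\Pi_0,\dots,\Pi_{n_x-1}$ are selected, with $n_x\le n!$. Each $\Pi_x$ is a product in which every $U_i$ appears exactly once, in an order specified by a permutation. A Hadamard matrix $s(x,y)$ of size $n_x\times n_x$ is also fixed: $s(x,y)\in\{+1,-1\}$ and $\sum_x s(x,y)s(x,y')=n_x\delta_{y,y'}$. It is promised that there exists $y$ such that $\Pi_x=s(x,y)\,\Pi_0$ for all $x$. The task is to determine $y$. Composition method. Let HPP1 have $m$ gates, products $\Pi^{(1)}_{x_1}$ and Hadamard matrix $s_1$ (size $m_x$). Let HPP2 have $n'$ gates, products $\Pi^{(2)}_{x_2}$ and Hadamard matrix $s_2$ (size $n'_x$). Choose one gate of HPP1 and replace it, in every $\Pi^{(1)}_{x_1}$, by $\Pi^{(2)}_{x_2}$; the gates of HPP2 are new, distinct gates. This yields $m_xn'_x$ products $\Pi_{(x_1,x_2)}$ on $m+n'-1$ gates, with Hadamard matrix $s((x_1,x_2),(y_1,y_2))=s_1(x_1,y_1)s_2(x_2,y_2)$.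 The promise is that for some $(y_1,y_2)$, $\Pi_{(x_1,x_2)}=s((x_1,x_2),(y_1,y_2))\Pi_{(0,0)}$ for all $(x_1,x_2)$. The class $\mathcal{C}$ consists of the HPPs in $\mathcal{F}$ together with all HPPs obtained by repeatedly composing HPPs already in $\mathcal{C}$ (each time using fresh gates). Causal quantum algorithm. This is an ordinary quantum circuit on a finite-dimensional system (target and ancillas). It consists of fixed, instance-independent gates (e.g. Hadamard-type transforms and controlled swaps) and a fixed sequence of calls to the black-box gates. Each call applies some $U_i$ to a $d$-dimensional subsystem, in a fixed (not quantum-controlled) order. The circuit ends with a measurement in the computational basis. Solving the problem means outputting the promised $y$ for every tuple of unitaries satisfying the promise. The query count is the total number of black-box calls. *)

theory Defs
  imports Complex_Main
begin

section \<open>Matrices on C^d (entries outside {0..<d} are ignored)\<close>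

type_synonym cmat = "nat \<Rightarrow> nat \<Rightarrow> complex"

definition mmul :: "nat \<Rightarrow> cmat \<Rightarrow> cmat \<Rightarrow> cmat" where
  "mmul d A B = (\<lambda>i k. \<Sum>j<d. A i j * B j k)"

definition mident :: cmat where
  "mident = (\<lambda>i k. if i = k then 1 else 0)"

definition unitary_d :: "nat \<Rightarrow> cmat \<Rightarrow> bool" where
  "unitary_d d M \<longleftrightarrow>
     (\<forall>a<d. \<forall>c<d. (\<Sum>j<d. cnj (M j a) * M j c) = (if a = c then 1 else 0))"

definition gate_prod :: "nat \<Rightarrow> (nat \<Rightarrow> cmat) \<Rightarrow> nat list \<Rightarrow> cmat" where
  "gate_prod d U l = foldr (\<lambda>i M. mmul d (U i) M) l mident"

record hpp =
  ngates :: nat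
  nprods :: nat
  order :: "nat \<Rightarrow> nat list"
  hsign :: "nat \<Rightarrow> nat \<Rightarrow> int"

definition valid_hpp :: "hpp \<Rightarrow> bool" where
  "valid_hpp P \<longleftrightarrow>
     1 \<le> nprods P \<and> nprods P \<le> fact (ngates P) \<and>
     (\<forall>x<nprods P. distinct (order P x) \<and> set (order P x) = {0..<ngates P}) \<and>
     (\<forall>x<nprods P. \<forall>y<nprods P. hsign P x y = 1 \<or> hsign P x y = -1) \<and>
     (\<forall>y<nprods P. \<forall>y'<nprods P.
        (\<Sum>x<nprods P. hsign P x y * hsign P x y') = (if y = y' then int (nprods P) else 0))"

definition promise :: "hpp \<Rightarrow> nat \<Rightarrow> (nat \<Rightarrow> cmat) \<Rightarrow> nat \<Rightarrow> bool" where
  "promise P d U y \<longleftrightarrow>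
     (\<forall>i<ngates P. unitary_d d (U i)) \<and> y < nprods P \<and>
     (\<forall>x<nprods P. \<forall>a<d. \<forall>c<d.
        gate_prod d U (order P x) a c = of_int (hsign P x y) * gate_prod d U (order P 0) a c)"

text \<open>Composition: gate g of P1 is replaced (in every product) by the products of P2.
  Gates of P1 other than g are renumbered 0..m-2 (order preserved), gates of P2 become
  m-1,...,m+n'-2 (fresh). The index pair (x1,x2) is encoded as x1 * n'_x + x2, so
  (0,0) is encoded as 0.\<close>
definition compose :: "hpp \<Rightarrow> nat \<Rightarrow> hpp \<Rightarrow> hpp" where
  "compose P1 g P2 =
    (let m = ngates P1; n2 = ngates P2; k2 = nprods P2;
         ren = (\<lambda>i. if i < g then i else i - 1)
     in \<lparr> ngates = m + n2 - 1,
          nprods = nprods P1 * k2,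
          order = (\<lambda>x. concat (map (\<lambda>i. if i = g then map (\<lambda>j. m - 1 + j) (order P2 (x mod k2))
                                           else [ren i]) (order P1 (x div k2)))),
          hsign = (\<lambda>x y. hsign P1 (x div k2) (y div k2) * hsign P2 (x mod k2) (y mod k2)) \<rparr>)"

inductive_set hpp_class :: "hpp set \<Rightarrow> hpp set" for F where
  base: "P \<in> F \<Longrightarrow> P \<in> hpp_class F"
| comp: "P1 \<in> hpp_class F \<Longrightarrow> P2 \<in> hpp_class F \<Longrightarrow> g < ngates P1 \<Longrightarrow>
         compose P1 g P2 \<in> hpp_class F"

text \<open>The system consists of m registers of dimension d (on which black-box gates may act)
  and an ancilla of dimension A. Computational basis states are pairs (as, b) with
  length as = m, all entries of as below d, and b < A.\<close>
definition basis :: "nat \<Rightarrow> nat \<Rightarrow> nat \<Rightarrow> (nat list \<times> nat) set" where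
  "basis m d A = {(as, b). length as = m \<and> (\<forall>a\<in>set as. a < d) \<and> b < A}"

type_synonym qstate = "nat list \<times> nat \<Rightarrow> complex"
type_synonym qop = "nat list \<times> nat \<Rightarrow> nat list \<times> nat \<Rightarrow> complex"

datatype instr =
    Fixed qop
  | Query nat nat

record qalg =
  nregs :: nat
  ancdim :: nat
  instrs :: "instr list"
  outmap :: "nat list \<times> nat \<Rightarrow> nat"

definition unitary_on :: "(nat list \<times> nat) set \<Rightarrow> qop \<Rightarrow> bool" where
  "unitary_on B G \<longleftrightarrow>
     (\<forall>\<beta>\<in>B. \<forall>\<gamma>\<in>B. (\<Sum>\<alpha>\<in>B. cnj (G \<alpha> \<beta>) * G \<alpha> \<gamma>) = (if \<beta> = \<gamma> then 1 else 0))"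

definition wf_instr :: "nat \<Rightarrow> nat \<Rightarrow> nat \<Rightarrow> nat \<Rightarrow> instr \<Rightarrow> bool" where
  "wf_instr n m d A ins =
     (case ins of Fixed G \<Rightarrow> unitary_on (basis m d A) G
                | Query i j \<Rightarrow> i < n \<and> j < m)"

definition wf_alg :: "nat \<Rightarrow> nat \<Rightarrow> qalg \<Rightarrow> bool" where
  "wf_alg n d Q \<longleftrightarrow> 1 \<le> ancdim Q \<and> (\<forall>ins\<in>set (instrs Q). wf_instr n (nregs Q) d (ancdim Q) ins)"

definition apply_instr :: "nat \<Rightarrow> nat \<Rightarrow> nat \<Rightarrow> (nat \<Rightarrow> cmat) \<Rightarrow> instr \<Rightarrow> qstate \<Rightarrow> qstate" where
  "apply_instr m d A U ins \<psi> =
     (case ins of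
        Fixed G \<Rightarrow> (\<lambda>\<beta>. if \<beta> \<in> basis m d A then (\<Sum>\<gamma>\<in>basis m d A. G \<beta> \<gamma> * \<psi> \<gamma>) else 0)
      | Query i j \<Rightarrow> (\<lambda>(as, b). if (as, b) \<in> basis m d A
                        then (\<Sum>a<d. U i (as ! j) a * \<psi> (as[j := a], b)) else 0))"

definition init_state :: "nat \<Rightarrow> qstate" where
  "init_state m = (\<lambda>\<beta>. if \<beta> = (replicate m 0, 0) then 1 else 0)"

definition final_state :: "nat \<Rightarrow> qalg \<Rightarrow> (nat \<Rightarrow> cmat) \<Rightarrow> qstate" where
  "final_state d Q U =
     fold (apply_instr (nregs Q) d (ancdim Q) U) (instrs Q) (init_state (nregs Q))"

definition solves :: "hpp \<Rightarrow> nat \<Rightarrow> qalg \<Rightarrow> bool" where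
  "solves P d Q \<longleftrightarrow>
     (\<forall>U y. promise P d U y \<longrightarrow>
        (\<forall>\<beta>\<in>basis (nregs Q) d (ancdim Q). final_state d Q U \<beta> \<noteq> 0 \<longrightarrow> outmap Q \<beta> = y))"

definition is_query :: "instr \<Rightarrow> bool" where
  "is_query ins = (case ins of Query _ _ \<Rightarrow> True | Fixed _ \<Rightarrow> False)"

definition num_queries :: "qalg \<Rightarrow> nat" where
  "num_queries Q = length (filter is_query (instrs Q))"

end

theory Submission
  imports Defs "HOL-Library.Sublist" "HOL-Library.FuncSet"
begin

text \<open>A scan is the following experiment: in the products of a composite problem, fix some of the
  choices and put the remaining ones in superposition. The products
  under comparison then share a prefix and a suffix, which cancel, so that only the window between
  them has to be run, and the promise makes the window of branch x equal to s(x,y) times a fixed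
  operator. A window is run in every branch by a fixed word of calls containing all of its orderings
  as subsequences; the calls that a branch does not need act on a dummy register. Measuring all scans
  reveals y as soon as any two columns of s are orthogonal on the branches of some scan.

  For a problem with k gates of which h has the largest weight, the word is
  (lights)^(k-1) h (lights)^(k-1), so that h is called only once and the others at most
  2(k-1) times. Since h is called once, a problem substituted for h may be scanned in the same run,
  whereas one substituted for a light gate is replaced there by its product number 0 and gets scans
  of its own. Assign weights \<omega> to the gates, with total W. The cost minus W is additive under
  composition, and so is the entropy W log W - sum \<omega> log \<omega>, by the chain rule. As a light gate has
  at most half of the weight, the cost of a single problem is controlled by its entropy, and the
  bound for all problems follows with all weights equal to 1.\<close>

section \<open>Black-box products acting on vectors\<close>

text \<open>M M* is a self-adjoint idempotent of trace d, hence 1 - M M* has Hilbert--Schmidt norm 0.\<close>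

lemma unitary_d_right_inverse:
  assumes "unitary_d d M" "i < d" "k < d"
  shows "(\<Sum>a<d. M i a * cnj (M k a)) = (if i = k then 1 else 0)"
proof -
  define R where "R i k = (\<Sum>a<d. M i a * cnj (M k a))" for i k
  define D :: "nat \<Rightarrow> nat \<Rightarrow> complex" where "D i k = (if i = k then 1 else 0)" for i k
  have U: "(\<Sum>j<d. cnj (M j a) * M j c) = D a c" if "a < d" "c < d" for a c
    using assms(1) that unfolding unitary_d_def D_def by auto
  have U': "(\<Sum>j<d. M j a * cnj (M j c)) = D a c" if "a < d" "c < d" for a c
    using U[of c a] that by (simp add: mult.commute D_def)
  have tr: "(\<Sum>i<d. R i i) = of_nat d"
  proof -
    have "(\<Sum>i<d. R i i) = (\<Sum>a<d. \<Sum>i<d. M i a * cnj (M i a))"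
      unfolding R_def by (rule sum.swap)
    also have "\<dots> = (\<Sum>a<d. 1)"
      by (rule sum.cong) (auto simp: U' D_def)
    finally show ?thesis by simp
  qed
  \<comment> \<open>Summing over \<open>i\<close> and \<open>k\<close> first turns each factor into
    an entry of M* M, that is of \<open>D\<close>: this is the trace of (M* M)^2.\<close>
  have sq: "(\<Sum>i<d. \<Sum>k<d. R i k * cnj (R i k)) = of_nat d"
  proof -
    have "(\<Sum>i<d. \<Sum>k<d. R i k * cnj (R i k))
        = (\<Sum>i<d. \<Sum>k<d. \<Sum>a<d. \<Sum>c<d. (M i a * cnj (M i c)) * (cnj (M k a) * M k c))"
      unfolding R_def by (simp add: sum_product mult_ac)
    also have "\<dots> = (\<Sum>i<d. \<Sum>a<d. \<Sum>k<d. \<Sum>c<d. (M i a * cnj (M i c)) * (cnj (M k a) * M k c))"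
      by (rule sum.cong[OF refl], rule sum.swap)
    also have "\<dots> = (\<Sum>a<d. \<Sum>i<d. \<Sum>k<d. \<Sum>c<d. (M i a * cnj (M i c)) * (cnj (M k a) * M k c))"
      by (rule sum.swap)
    also have "\<dots> = (\<Sum>a<d. \<Sum>i<d. \<Sum>c<d. \<Sum>k<d. (M i a * cnj (M i c)) * (cnj (M k a) * M k c))"
      by (rule sum.cong[OF refl], rule sum.cong[OF refl], rule sum.swap)
    also have "\<dots> = (\<Sum>a<d. \<Sum>c<d. \<Sum>i<d. \<Sum>k<d. (M i a * cnj (M i c)) * (cnj (M k a) * M k c))"
      by (rule sum.cong[OF refl], rule sum.swap)
    also have "\<dots> = (\<Sum>a<d. \<Sum>c<d. D a c * D a c)"
      by (rule sum.cong[OF refl], rule sum.cong[OF refl])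
        (simp add: U U' sum_distrib_left[symmetric] sum_distrib_right[symmetric])
    also have "\<dots> = (\<Sum>a<d. 1)"
      by (rule sum.cong) (auto simp: D_def if_distrib[of "\<lambda>x. x * _"] cong: if_cong)
    finally show ?thesis by simp
  qed
  have cj: "(\<Sum>i<d. cnj (R i i)) = of_nat d"
    using arg_cong[OF tr, of cnj] by simp
  have DD: "(\<Sum>k<d. D i k * f k) = f i" if "i < d" for i f
    using that by (simp add: D_def if_distrib[of "\<lambda>x. x * _"] cong: if_cong)
  have D1: "(\<Sum>k<d. D i k) = 1" if "i < d" for i
    using that by (simp add: D_def)
  have "complex_of_real (\<Sum>i<d. \<Sum>k<d. (cmod (D i k - R i k))\<^sup>2)
      = (\<Sum>i<d. \<Sum>k<d. (D i k - R i k) * cnj (D i k - R i k))"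
    unfolding of_real_sum complex_norm_square ..
  also have "\<dots> = (\<Sum>i<d. \<Sum>k<d. D i k * 1) - (\<Sum>i<d. \<Sum>k<d. D i k * R i k)
      - (\<Sum>i<d. \<Sum>k<d. D i k * cnj (R i k)) + (\<Sum>i<d. \<Sum>k<d. R i k * cnj (R i k))"
    unfolding sum_subtractf[symmetric] sum.distrib[symmetric]
    by (intro sum.cong refl) (auto simp: D_def algebra_simps)
  also have "\<dots> = 0" by (simp only: sq) (simp add: DD D1 tr cj)
  finally have "(\<Sum>i<d. \<Sum>k<d. (cmod (D i k - R i k))\<^sup>2) = 0"
    using of_real_eq_0_iff by blast
  then have "(\<Sum>k<d. (cmod (D i k - R i k))\<^sup>2) = 0"
    using assms(2) by (subst (asm) sum_nonneg_eq_0_iff) (auto intro: sum_nonneg)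
  then have "(cmod (D i k - R i k))\<^sup>2 = 0"
    using assms(3) by (subst (asm) sum_nonneg_eq_0_iff) auto
  then show ?thesis by (simp add: R_def D_def)
qed


definition gact :: "nat \<Rightarrow> cmat \<Rightarrow> (nat \<Rightarrow> complex) \<Rightarrow> nat \<Rightarrow> complex" where
  "gact d M v = (\<lambda>r. \<Sum>a<d. M r a * v a)"

definition run :: "nat \<Rightarrow> (nat \<Rightarrow> cmat) \<Rightarrow> nat list \<Rightarrow> (nat \<Rightarrow> complex) \<Rightarrow> nat \<Rightarrow> complex" where
  "run d U l v = foldr (\<lambda>i. gact d (U i)) l v"

lemma run_simps [simp]:
  "run d U [] v = v"
  "run d U (i # l) v = gact d (U i) (run d U l v)"
  "run d U (l @ l') v = run d U l (run d U l' v)"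
  by (simp_all add: run_def)

lemma gact_cong: "(\<And>a. a < d \<Longrightarrow> v a = v' a) \<Longrightarrow> gact d M v = gact d M v'"
  unfolding gact_def by (intro ext sum.cong) auto

lemma run_cong:
  "(\<And>a. a < d \<Longrightarrow> v a = v' a) \<Longrightarrow> r < d \<Longrightarrow> run d U l v r = run d U l v' r"
proof (induction l arbitrary: r)
  case (Cons i l)
  have "gact d (U i) (run d U l v) = gact d (U i) (run d U l v')"
    by (rule gact_cong) (use Cons in auto)
  then show ?case by simp
qed simp

lemma run_scale: "run d U l (\<lambda>r. c * v r) = (\<lambda>r. c * run d U l v r)"
  by (induction l) (auto simp: gact_def sum_distrib_left mult_ac)

lemma run_gate_prod:
  "r < d \<Longrightarrow> run d U l v r = (\<Sum>c<d. gate_prod d U l r c * v c)"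
proof (induction l arbitrary: r)
  case Nil
  have "(\<Sum>c<d. mident r c * v c) = (\<Sum>c<d. if r = c then v c else 0)"
    by (rule sum.cong) (auto simp: mident_def)
  then show ?case using Nil by (simp add: gate_prod_def)
next
  case (Cons i l)
  have "run d U (i # l) v r = (\<Sum>a<d. U i r a * (\<Sum>c<d. gate_prod d U l a c * v c))"
    unfolding run_simps gact_def by (intro sum.cong refl) (simp add: Cons.IH)
  also have "\<dots> = (\<Sum>a<d. \<Sum>c<d. U i r a * gate_prod d U l a c * v c)"
    by (simp add: sum_distrib_left mult_ac)
  also have "\<dots> = (\<Sum>c<d. \<Sum>a<d. U i r a * gate_prod d U l a c * v c)"
    by (rule sum.swap)
  also have "\<dots> = (\<Sum>c<d. gate_prod d U (i # l) r c * v c)"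
    by (simp add: gate_prod_def mmul_def sum_distrib_right)
  finally show ?case .
qed

text \<open>The first equation is \<open>unitary_d\<close> itself. The second one concerns M M*,
  hence rests on \<open>unitary_d_right_inverse\<close>; it makes gate products surjective.\<close>

lemma gact_adjoint:
  assumes "unitary_d d M" "r < d"
  shows "gact d (\<lambda>i j. cnj (M j i)) (gact d M v) r = v r"
    and "gact d M (gact d (\<lambda>i j. cnj (M j i)) v) r = v r"
proof -
  have "(\<Sum>a<d. cnj (M a r) * (\<Sum>c<d. M a c * v c)) = (\<Sum>a<d. \<Sum>c<d. cnj (M a r) * M a c * v c)"
    by (simp add: sum_distrib_left mult_ac)
  also have "\<dots> = (\<Sum>c<d. \<Sum>a<d. cnj (M a r) * M a c * v c)" by (rule sum.swap)
  also have "\<dots> = (\<Sum>c<d. (if r = c then 1 else 0) * v c)"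
    using assms by (intro sum.cong refl) (auto simp: unitary_d_def sum_distrib_right[symmetric])
  also have "\<dots> = v r" using assms(2) by (simp add: if_distrib[of "\<lambda>x. x * _"] cong: if_cong)
  finally show "gact d (\<lambda>i j. cnj (M j i)) (gact d M v) r = v r" by (simp add: gact_def)
  have "(\<Sum>a<d. M r a * (\<Sum>c<d. cnj (M c a) * v c)) = (\<Sum>a<d. \<Sum>c<d. M r a * cnj (M c a) * v c)"
    by (simp add: sum_distrib_left mult_ac)
  also have "\<dots> = (\<Sum>c<d. \<Sum>a<d. M r a * cnj (M c a) * v c)" by (rule sum.swap)
  also have "\<dots> = (\<Sum>c<d. (if r = c then 1 else 0) * v c)"
    using assms by (intro sum.cong refl)
      (auto simp: unitary_d_right_inverse sum_distrib_right[symmetric])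
  also have "\<dots> = v r" using assms(2) by (simp add: if_distrib[of "\<lambda>x. x * _"] cong: if_cong)
  finally show "gact d M (gact d (\<lambda>i j. cnj (M j i)) v) r = v r" by (simp add: gact_def)
qed

text \<open>Strips a prefix shared by all branches: adjoints undo its gates one by one.\<close>

lemma run_injective:
  assumes "\<forall>i\<in>set l. unitary_d d (U i)" "\<forall>r<d. run d U l v r = run d U l v' r" "r < d"
  shows "v r = v' r"
  using assms
proof (induction l arbitrary: r)
  case (Cons i l)
  have "\<forall>r<d. run d U l v r = run d U l v' r"
  proof (intro allI impI)
    fix r assume r: "r < d"
    have "gact d (\<lambda>a b. cnj (U i b a)) (gact d (U i) (run d U l v)) r
        = gact d (\<lambda>a b. cnj (U i b a)) (gact d (U i) (run d U l v')) r"
      by (rule fun_cong[OF gact_cong]) (use Cons.prems(2) in simp)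
    then show "run d U l v r = run d U l v' r"
      using Cons.prems(1) r by (simp add: gact_adjoint)
  qed
  then show ?case using Cons by auto
qed simp

text \<open>Strips a shared suffix: every input of a window is the output of the suffix on some
  vector, found by pulling \<open>u\<close> back through the adjoints, starting with the first gate
  of the list.\<close>

lemma run_surjective:
  assumes "\<forall>i\<in>set l. unitary_d d (U i)"
  shows "\<exists>v. \<forall>r<d. run d U l v r = u r"
  using assms
proof (induction l arbitrary: u)
  case (Cons i l)
  obtain v where v: "\<forall>r<d. run d U l v r = gact d (\<lambda>a b. cnj (U i b a)) u r"
    using Cons.IH[of "gact d (\<lambda>a b. cnj (U i b a)) u"] Cons.prems by auto
  have "gact d (U i) (run d U l v) = gact d (U i) (gact d (\<lambda>a b. cnj (U i b a)) u)"
    by (rule gact_cong) (use v in auto)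
  then show ?case using Cons.prems by (intro exI[of _ v]) (simp add: gact_adjoint)
qed auto

text \<open>The invariant that compositions preserve. Orthogonality of the columns of
  \<open>hsign\<close> is passed on in terms of scans, by \<open>separates\<close>.\<close>

definition wf_hpp :: "hpp \<Rightarrow> bool" where
  "wf_hpp P \<longleftrightarrow> 1 \<le> nprods P \<and>
     (\<forall>x<nprods P. distinct (order P x) \<and> set (order P x) = {0..<ngates P}) \<and>
     (\<forall>x<nprods P. \<forall>y<nprods P. hsign P x y = 1 \<or> hsign P x y = -1)"

text \<open>In branch x, a scan runs the part of order P x between pre and post.\<close>

record scan =
  pre :: "nat list"
  branches :: "nat set"
  "word" :: "nat list"
  post :: "nat list"

definition scan_ok :: "hpp \<Rightarrow> scan \<Rightarrow> bool" where
  "scan_ok P s \<longleftrightarrow> branches s \<noteq> {} \<and> branches s \<subseteq> {..<nprods P} \<and> set (word s) \<subseteq> {..<ngates P} \<and>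
     (\<forall>x\<in>branches s. \<exists>q. order P x = pre s @ q @ post s \<and> subseq q (word s))"

text \<open>Scans run side by side produce a tensor product of sign vectors, so the inner product of
  the vectors for \<open>y\<close> and \<open>y'\<close> is, up to normalization, the product of
  these sums. One vanishing sum makes the two answers distinguishable.\<close>

definition separates :: "hpp \<Rightarrow> scan set \<Rightarrow> bool" where
  "separates P S \<longleftrightarrow> (\<forall>y<nprods P. \<forall>y'<nprods P. y \<noteq> y' \<longrightarrow>
     (\<exists>s\<in>S. (\<Sum>x\<in>branches s. hsign P x y * hsign P x y') = 0))"

text \<open>Cancelling the common prefix and suffix turns the promise into one on the windows.\<close>

lemma promise_window:
  assumes P: "wf_hpp P" and pr: "promise P d U y"
    and X: "X \<subseteq> {..<nprods P}" "X \<noteq> {}"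
    and q: "\<And>x. x \<in> X \<Longrightarrow> order P x = a @ q x @ b"
  shows "\<exists>\<mu>. \<forall>x\<in>X. \<forall>r<d. run d U (q x) u r = of_int (hsign P x y) * \<mu> r"
proof -
  obtain x0 where x0: "x0 \<in> X" using X by auto
  have gates: "set (order P x) \<subseteq> {..<ngates P}" if "x \<in> X" for x
    using P X that by (auto simp: wf_hpp_def)
  have un: "\<forall>i\<in>set (order P x0). unitary_d d (U i)"
    using gates[OF x0] pr by (auto simp: promise_def)
  \<comment> \<open>The input \<open>u\<close> of the windows is traced back through the suffix, so
    that the promise on complete products applies to \<open>v\<close>.\<close>
  obtain v where v: "\<forall>r<d. run d U b v r = u r"
    using run_surjective[of b d U u] un q[OF x0] by auto
  have tot: "run d U a (run d U (q x) u) r = of_int (hsign P x y) * run d U (order P 0) v r"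
    if x: "x \<in> X" and r: "r < d" for x r
  proof -
    have "run d U a (run d U (q x) u) r = run d U (a @ q x) u r" by simp
    also have "\<dots> = run d U (a @ q x) (run d U b v) r"
      by (rule run_cong) (use v r in auto)
    also have "\<dots> = run d U (order P x) v r" by (simp add: q x)
    also have "\<dots> = (\<Sum>c<d. of_int (hsign P x y) * gate_prod d U (order P 0) r c * v c)"
    proof -
      have "gate_prod d U (order P x) r c = of_int (hsign P x y) * gate_prod d U (order P 0) r c"
        if "c < d" for c
        using pr X x r that unfolding promise_def by blast
      then show ?thesis unfolding run_gate_prod[OF r] by (intro sum.cong) simp_all
    qed
    also have "\<dots> = of_int (hsign P x y) * run d U (order P 0) v r"
      unfolding run_gate_prod[OF r] by (simp add: sum_distrib_left mult_ac)
    finally show ?thesis .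
  qed
  have sq: "(of_int (hsign P x y) :: complex) * of_int (hsign P x y) = 1" if "x \<in> X" for x
  proof -
    have "hsign P x y = 1 \<or> hsign P x y = -1" using P pr X that by (auto simp: wf_hpp_def promise_def)
    then show ?thesis by auto
  qed
  \<comment> \<open>The branch \<open>x0\<close> serves as reference; its sign is its own
    inverse.\<close>
  define \<mu> where "\<mu> r = of_int (hsign P x0 y) * run d U (q x0) u r" for r
  have "run d U (q x) u r = of_int (hsign P x y) * \<mu> r" if x: "x \<in> X" and r: "r < d" for x r
  proof -
    let ?c = "of_int (hsign P x y) * of_int (hsign P x0 y) :: complex"
    have "run d U (q x) u r = ?c * run d U (q x0) u r"
    \<comment> \<open>Both vectors agree after the prefix \<open>a\<close> has acted, hence already
      before it.\<close>
    proof (rule run_injective[of a d U])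
      show "\<forall>i\<in>set a. unitary_d d (U i)" using un q[OF x0] by auto
      show "\<forall>r<d. run d U a (run d U (q x) u) r = run d U a (\<lambda>r. ?c * run d U (q x0) u r) r"
      proof (intro allI impI)
        fix r assume r: "r < d"
        have "run d U a (\<lambda>r. ?c * run d U (q x0) u r) r
            = of_int (hsign P x y) * (of_int (hsign P x0 y) * of_int (hsign P x0 y))
              * run d U (order P 0) v r"
          by (simp add: run_scale tot[OF x0 r] mult.assoc)
        then show "run d U a (run d U (q x) u) r = run d U a (\<lambda>r. ?c * run d U (q x0) u r) r"
          by (simp only: sq[OF x0] tot[OF x r] mult_1_right)
      qed
    qed (rule r)
    then show ?thesis by (simp add: \<mu>_def mult.assoc)
  qed
  then show ?thesis by blast
qed


section \<open>Circuits on product states\<close>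

lemma basis_eq: "basis m d A = {as. length as = m \<and> (\<forall>a\<in>set as. a < d)} \<times> {..<A}"
  by (auto simp: basis_def)

lemma finite_regs: "finite {as. length as = m \<and> (\<forall>a\<in>set as. a < (d::nat))}"
proof -
  have "{as. length as = m \<and> (\<forall>a\<in>set as. a < d)} = {as. set as \<subseteq> {..<d} \<and> length as = m}"
    by auto
  then show ?thesis by (simp add: finite_lists_length_eq)
qed

lemma finite_basis: "finite (basis m d A)"
  by (simp add: basis_eq finite_regs)

text \<open>A superposition over ancilla values b, where the registers are in a product state for each b.\<close>

definition pstate :: "nat \<Rightarrow> nat \<Rightarrow> nat \<Rightarrow> (nat \<Rightarrow> complex) \<Rightarrow> (nat \<Rightarrow> nat \<Rightarrow> nat \<Rightarrow> complex) \<Rightarrow> qstate" where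
  "pstate m d A c \<phi> =
     (\<lambda>(as, b). if (as, b) \<in> basis m d A then c b * (\<Prod>j<m. \<phi> b j (as ! j)) else 0)"

lemma pstate_cong:
  assumes "\<And>b j r. b < A \<Longrightarrow> j < m \<Longrightarrow> r < d \<Longrightarrow> \<phi> b j r = \<phi>' b j r"
    and "\<And>b. b < A \<Longrightarrow> c b = c' b"
  shows "pstate m d A c \<phi> = pstate m d A c' \<phi>'"
  unfolding pstate_def
  by (intro ext) (auto simp: basis_def assms intro!: prod.cong)

lemma apply_query_pstate:
  assumes "j < m"
  shows "apply_instr m d A U (Query i j) (pstate m d A c \<phi>)
       = pstate m d A c (\<lambda>b. (\<phi> b)(j := gact d (U i) (\<phi> b j)))"
proof (intro ext)
  fix \<beta> :: "nat list \<times> nat"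
  obtain as b where \<beta>: "\<beta> = (as, b)" by force
  show "apply_instr m d A U (Query i j) (pstate m d A c \<phi>) \<beta>
      = pstate m d A c (\<lambda>b. (\<phi> b)(j := gact d (U i) (\<phi> b j))) \<beta>"
  proof (cases "(as, b) \<in> basis m d A")
    case True
    have up: "(as[j := a], b) \<in> basis m d A" if "a < d" for a
      using True that set_update_subset_insert[of as j a] by (auto simp: basis_def)
    have len: "length as = m" using True by (simp add: basis_def)
    have split: "(\<Prod>k<m. f k) = f j * (\<Prod>k\<in>{..<m} - {j}. f k)" for f :: "nat \<Rightarrow> complex"
      using assms by (simp add: prod.remove)
    have "(\<Sum>a<d. U i (as ! j) a * pstate m d A c \<phi> (as[j := a], b))
        = (\<Sum>a<d. U i (as ! j) a * (c b * (\<phi> b j a * (\<Prod>k\<in>{..<m} - {j}. \<phi> b k (as ! k)))))"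
    proof (rule sum.cong[OF refl])
      fix a assume "a \<in> {..<d}"
      then have "pstate m d A c \<phi> (as[j := a], b) = c b * (\<Prod>k<m. \<phi> b k (as[j := a] ! k))"
        by (simp add: pstate_def up)
      also have "\<dots> = c b * (\<phi> b j a * (\<Prod>k\<in>{..<m} - {j}. \<phi> b k (as ! k)))"
        unfolding split using assms len by simp
      finally show "U i (as ! j) a * pstate m d A c \<phi> (as[j := a], b)
        = U i (as ! j) a * (c b * (\<phi> b j a * (\<Prod>k\<in>{..<m} - {j}. \<phi> b k (as ! k))))" by simp
    qed
    also have "\<dots> = c b * (gact d (U i) (\<phi> b j) (as ! j) * (\<Prod>k\<in>{..<m} - {j}. \<phi> b k (as ! k)))"
      by (simp add: gact_def sum_distrib_left sum_distrib_right mult_ac)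
    also have "\<dots> = c b * (\<Prod>k<m. ((\<phi> b)(j := gact d (U i) (\<phi> b j))) k (as ! k))"
      unfolding split by simp
    finally show ?thesis using True by (simp add: \<beta> apply_instr_def pstate_def[of _ _ _ _ "\<lambda>b. (\<phi> b)(j := _ b)"])
  qed (simp add: \<beta> apply_instr_def pstate_def)
qed

section \<open>Ancilla-controlled swaps of registers\<close>

definition swap_regs :: "nat set \<Rightarrow> nat \<Rightarrow> nat \<Rightarrow> nat list \<times> nat \<Rightarrow> nat list \<times> nat" where
  "swap_regs S j k = (\<lambda>(as, b). (if b \<in> S then as[j := as ! k, k := as ! j] else as, b))"

definition cswap :: "nat set \<Rightarrow> nat \<Rightarrow> nat \<Rightarrow> qop" where
  "cswap S j k = (\<lambda>\<alpha> \<beta>. if \<beta> = swap_regs S j k \<alpha> then 1 else 0)"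

lemma swap_regs_basis:
  "j < m \<Longrightarrow> k < m \<Longrightarrow> \<beta> \<in> basis m d A \<Longrightarrow> swap_regs S j k \<beta> \<in> basis m d A"
  by (auto simp: swap_regs_def basis_def set_swap split: if_splits)

lemma swap_regs_invol:
  "j < m \<Longrightarrow> k < m \<Longrightarrow> \<beta> \<in> basis m d A \<Longrightarrow> swap_regs S j k (swap_regs S j k \<beta>) = \<beta>"
  by (auto simp: swap_regs_def basis_def nth_list_update intro!: nth_equalityI)

text \<open>\<open>swap_regs\<close> is an involution on the basis, so \<open>cswap\<close> is a
  permutation matrix: column \<beta> has its only nonzero entry in row
  \<open>swap_regs S j k \<beta>\<close>.\<close>

lemma unitary_cswap:
  assumes "j < m" "k < m"
  shows "unitary_on (basis m d A) (cswap S j k)"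
  unfolding unitary_on_def
proof (intro ballI)
  fix \<beta> \<gamma> assume b: "\<beta> \<in> basis m d A" and c: "\<gamma> \<in> basis m d A"
  let ?s = "swap_regs S j k"
  have "(\<Sum>\<alpha>\<in>basis m d A. cnj (cswap S j k \<alpha> \<beta>) * cswap S j k \<alpha> \<gamma>)
      = (\<Sum>\<alpha>\<in>basis m d A. if \<alpha> = ?s \<beta> then (if \<beta> = \<gamma> then 1 else 0) else 0)"
    by (rule sum.cong) (use assms b c in \<open>auto simp: cswap_def swap_regs_invol\<close>)
  also have "\<dots> = (if \<beta> = \<gamma> then 1 else 0)"
    using swap_regs_basis[OF assms b] by (simp add: finite_basis)
  finally show "(\<Sum>\<alpha>\<in>basis m d A. cnj (cswap S j k \<alpha> \<beta>) * cswap S j k \<alpha> \<gamma>) = (if \<beta> = \<gamma> then 1 else 0)" .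
qed

lemma apply_cswap:
  assumes "j < m" "k < m" "\<beta> \<in> basis m d A"
  shows "apply_instr m d A U (Fixed (cswap S j k)) \<psi> \<beta> = \<psi> (swap_regs S j k \<beta>)"
  using assms swap_regs_basis[OF assms]
  by (simp add: apply_instr_def cswap_def finite_basis if_distrib[of "\<lambda>x. x * _"] cong: if_cong)

lemma apply_cswap_pstate:
  assumes "j < m" "k < m" "j \<noteq> k"
  shows "apply_instr m d A U (Fixed (cswap S j k)) (pstate m d A c \<phi>)
       = pstate m d A c (\<lambda>b. if b \<in> S then (\<phi> b)(j := \<phi> b k, k := \<phi> b j) else \<phi> b)"
proof (intro ext)
  fix \<beta> :: "nat list \<times> nat"
  obtain as b where \<beta>: "\<beta> = (as, b)" by force
  show "apply_instr m d A U (Fixed (cswap S j k)) (pstate m d A c \<phi>) \<beta>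
      = pstate m d A c (\<lambda>b. if b \<in> S then (\<phi> b)(j := \<phi> b k, k := \<phi> b j) else \<phi> b) \<beta>"
  proof (cases "(as, b) \<in> basis m d A")
    case True
    have len: "length as = m" using True by (simp add: basis_def)
    have split: "(\<Prod>l<m. f l) = f j * f k * (\<Prod>l\<in>{..<m} - {j} - {k}. f l)" for f :: "nat \<Rightarrow> complex"
    proof -
      have "(\<Prod>l<m. f l) = f j * (\<Prod>l\<in>{..<m} - {j}. f l)" using assms by (simp add: prod.remove)
      also have "(\<Prod>l\<in>{..<m} - {j}. f l) = f k * (\<Prod>l\<in>{..<m} - {j} - {k}. f l)"
        using assms by (simp add: prod.remove)
      finally show ?thesis by (simp add: mult_ac)
    qed
    have sw: "swap_regs S j k (as, b) \<in> basis m d A"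
      by (rule swap_regs_basis[OF assms(1,2) True])
    have "(\<Prod>l<m. \<phi> b l (as[j := as ! k, k := as ! j] ! l))
        = (\<Prod>l<m. ((\<phi> b)(j := \<phi> b k, k := \<phi> b j)) l (as ! l))"
      unfolding split using assms len by (simp add: mult_ac)
    then show ?thesis
      using sw True unfolding \<beta> apply_cswap[OF assms(1,2) True]
      by (auto simp: pstate_def swap_regs_def)
  qed (simp add: \<beta> apply_instr_def pstate_def)
qed

section \<open>Gates acting on the ancilla alone\<close>

definition anc_op :: "(nat \<Rightarrow> nat \<Rightarrow> complex) \<Rightarrow> qop" where
  "anc_op g = (\<lambda>(as, b) (as', b'). if as = as' then g b b' else 0)"

lemma unitary_anc_op:
  assumes "\<And>b c. b < A \<Longrightarrow> c < A \<Longrightarrow> (\<Sum>a<A. cnj (g a b) * g a c) = (if b = c then 1 else 0)"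
  shows "unitary_on (basis m d A) (anc_op g)"
  unfolding unitary_on_def
proof (intro ballI)
  fix \<beta> \<gamma> assume b: "\<beta> \<in> basis m d A" and c: "\<gamma> \<in> basis m d A"
  obtain as x as' y where [simp]: "\<beta> = (as, x)" "\<gamma> = (as', y)" by force
  let ?L = "{as. length as = m \<and> (\<forall>a\<in>set as. a < d)}"
  have xy: "x < A" "y < A" "as \<in> ?L" using b c by (auto simp: basis_eq)
  have "(\<Sum>\<alpha>\<in>basis m d A. cnj (anc_op g \<alpha> \<beta>) * anc_op g \<alpha> \<gamma>)
      = (\<Sum>l\<in>?L. \<Sum>a<A. if l = as then (if as = as' then cnj (g a x) * g a y else 0) else 0)"
    unfolding basis_eq sum.cartesian_product'
    by (intro sum.cong refl) (auto simp: anc_op_def)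
  also have "\<dots> = (\<Sum>l\<in>?L. if l = as then (if as = as' then \<Sum>a<A. cnj (g a x) * g a y else 0) else 0)"
    by (intro sum.cong refl) auto
  also have "\<dots> = (if as = as' then \<Sum>a<A. cnj (g a x) * g a y else 0)"
    using xy by (simp add: finite_regs)
  also have "\<dots> = (if \<beta> = \<gamma> then 1 else 0)" using assms xy by simp
  finally show "(\<Sum>\<alpha>\<in>basis m d A. cnj (anc_op g \<alpha> \<beta>) * anc_op g \<alpha> \<gamma>) = (if \<beta> = \<gamma> then 1 else 0)" .
qed

text \<open>The common register state factors out of the sum over \<open>b'\<close>. This is why all
  branches have to reach the same register state, up to a scalar, before the ancilla is read
  out.\<close>

lemma apply_anc_op_pstate:
  "apply_instr m d A U (Fixed (anc_op g)) (pstate m d A c (\<lambda>_. \<phi>))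
     = pstate m d A (\<lambda>b. \<Sum>b'<A. g b b' * c b') (\<lambda>_. \<phi>)"
proof (intro ext)
  fix \<beta> :: "nat list \<times> nat"
  obtain as b where \<beta>: "\<beta> = (as, b)" by force
  let ?L = "{as. length as = m \<and> (\<forall>a\<in>set as. a < d)}"
  show "apply_instr m d A U (Fixed (anc_op g)) (pstate m d A c (\<lambda>_. \<phi>)) \<beta>
      = pstate m d A (\<lambda>b. \<Sum>b'<A. g b b' * c b') (\<lambda>_. \<phi>) \<beta>"
  proof (cases "(as, b) \<in> basis m d A")
    case True
    have "(\<Sum>\<gamma>\<in>basis m d A. anc_op g (as, b) \<gamma> * pstate m d A c (\<lambda>_. \<phi>) \<gamma>)
        = (\<Sum>l\<in>?L. \<Sum>b'<A. if l = as then g b b' * (c b' * (\<Prod>j<m. \<phi> j (l ! j))) else 0)"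
      unfolding basis_eq sum.cartesian_product'
      by (intro sum.cong refl) (auto simp: anc_op_def pstate_def basis_eq)
    also have "\<dots> = (\<Sum>l\<in>?L. if l = as then \<Sum>b'<A. g b b' * (c b' * (\<Prod>j<m. \<phi> j (l ! j))) else 0)"
      by (intro sum.cong refl) auto
    also have "\<dots> = (\<Sum>b'<A. g b b' * (c b' * (\<Prod>j<m. \<phi> j (as ! j))))"
      using True by (simp add: finite_regs basis_def)
    also have "\<dots> = (\<Sum>b'<A. g b b' * c b') * (\<Prod>j<m. \<phi> j (as ! j))"
      by (simp add: sum_distrib_right mult.assoc)
    finally show ?thesis using True by (simp add: \<beta> apply_instr_def pstate_def[of _ _ _ "\<lambda>b. \<Sum>b'<A. g b b' * c b'"])
  qed (simp add: \<beta> apply_instr_def pstate_def)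
qed

text \<open>Registers below \<open>N\<close> are targets, and register \<open>N + i\<close> is the
  dummy of gate \<open>i\<close>. The black box always acts at \<open>N + i\<close>; in the branches
  of \<open>S\<close> the target \<open>e\<close> is swapped in for the call. So the sequence of
  calls is the same in all branches.\<close>

definition call :: "nat \<Rightarrow> nat \<times> nat \<times> nat set \<Rightarrow> instr list" where
  "call N = (\<lambda>(e, i, S).
     [Fixed (cswap S e (N + i)), Query i (N + i), Fixed (cswap S e (N + i))])"

lemma fold_call_pstate:
  assumes "e < N" "i < n"
  shows "fold (apply_instr (N + n) d A U) (call N (e, i, S)) (pstate (N + n) d A c \<phi>)
       = pstate (N + n) d A c
           (\<lambda>b. let t = (if b \<in> S then e else N + i) in (\<phi> b)(t := gact d (U i) (\<phi> b t)))"
  using assms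
  by (simp add: call_def apply_cswap_pstate apply_query_pstate)
     (intro pstate_cong, auto simp: Let_def)

text \<open>Branch b routes a call (e, i, S) to the target register e if b lies in S, and to the
  dummy register of gate i otherwise. Since gate products act from the right, calls are
  issued in reverse order.\<close>

definition on_target :: "(nat \<times> nat \<times> nat set) list \<Rightarrow> nat \<Rightarrow> nat \<Rightarrow> nat list" where
  "on_target cs b e = map (\<lambda>(e, i, S). i) (filter (\<lambda>(e', i, S). e' = e \<and> b \<in> S) cs)"

definition on_dummy :: "(nat \<times> nat \<times> nat set) list \<Rightarrow> nat \<Rightarrow> nat \<Rightarrow> nat list" where
  "on_dummy cs b i = map (\<lambda>(e, i, S). i) (filter (\<lambda>(e, i', S). i' = i \<and> b \<notin> S) cs)"

lemma fold_calls_pstate: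
  assumes "\<forall>(e, i, S)\<in>set cs. e < N \<and> i < n"
  shows "fold (apply_instr (N + n) d A U) (concat (map (call N) (rev cs))) (pstate (N + n) d A c (\<lambda>_ _. v))
       = pstate (N + n) d A c
           (\<lambda>b j. run d U (if j < N then on_target cs b j else on_dummy cs b (j - N)) v)"
  using assms
proof (induction cs)
  case Nil
  show ?case by (auto simp: on_target_def on_dummy_def intro: pstate_cong)
next
  case (Cons x cs)
  obtain e i S where x: "x = (e, i, S)" by (cases x) auto
  have ei: "e < N" "i < n" using Cons.prems x by auto
  have "fold (apply_instr (N + n) d A U) (concat (map (call N) (rev (x # cs)))) (pstate (N + n) d A c (\<lambda>_ _. v))
     = fold (apply_instr (N + n) d A U) (call N (e, i, S)) (pstate (N + n) d A c
           (\<lambda>b j. run d U (if j < N then on_target cs b j else on_dummy cs b (j - N)) v))"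
    using Cons by (simp add: x)
  also have "\<dots> = pstate (N + n) d A c
           (\<lambda>b j. run d U (if j < N then on_target (x # cs) b j else on_dummy (x # cs) b (j - N)) v)"
    unfolding fold_call_pstate[OF ei]
    by (rule pstate_cong) (use ei in \<open>auto simp: Let_def x on_target_def on_dummy_def\<close>)
  finally show ?case .
qed

section \<open>Initial state and reflections of the ancilla\<close>

lemma init_state_pstate:
  assumes "1 \<le> d" "1 \<le> A"
  shows "init_state m = pstate m d A (\<lambda>b. if b = 0 then 1 else 0) (\<lambda>_ _ r. if r = 0 then 1 else 0)"
proof (intro ext)
  fix \<beta> :: "nat list \<times> nat"
  obtain as b where \<beta>: "\<beta> = (as, b)" by force
  have "(\<Prod>j<m. if as ! j = 0 then 1 else 0 :: complex) = (if as = replicate m 0 then 1 else 0)"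
    if len: "length as = m"
  proof (cases "as = replicate m 0")
    case False
    then obtain j where "j < m" "as ! j \<noteq> 0" using len by (auto simp: list_eq_iff_nth_eq)
    then have "(\<Prod>j<m. if as ! j = 0 then 1 else 0 :: complex) = 0"
      by (intro prod_zero) auto
    then show ?thesis using False by simp
  qed (auto intro!: prod.neutral)
  then show "init_state m \<beta> = pstate m d A (\<lambda>b. if b = 0 then 1 else 0) (\<lambda>_ _ r. if r = 0 then 1 else 0) \<beta>"
    using assms by (auto simp: \<beta> init_state_def pstate_def basis_def)
qed

text \<open>For orthogonal vectors q y of squared norm 2, each term q y (q y)^T swaps the parts u, v of
  q y = u - v, where u and v are orthonormal.\<close>

definition reflection :: "('y \<Rightarrow> nat \<Rightarrow> real) \<Rightarrow> 'y set \<Rightarrow> nat \<Rightarrow> nat \<Rightarrow> complex" where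
  "reflection q Y b c = of_real ((if b = c then 1 else 0) - (\<Sum>y\<in>Y. q y b * q y c))"

text \<open>Let S be the sum of the terms q y (q y)^T. Orthogonality with squared norm 2 gives S^2 =
  2 S, so (1 - S)^2 = 1, and 1 - S is real and symmetric.\<close>

lemma unitary_reflection:
  assumes Y: "finite Y"
    and orth: "\<And>y y'. y \<in> Y \<Longrightarrow> y' \<in> Y \<Longrightarrow> (\<Sum>b<A. q y b * q y' b) = (if y = y' then 2 else 0)"
  shows "unitary_on (basis m d A) (anc_op (reflection q Y))"
proof (rule unitary_anc_op)
  fix b c assume b: "b < A" and c: "c < A"
  let ?D = "\<lambda>a b. if a = b then 1 else 0 :: real"
  have e1: "(\<Sum>a<A. ?D a b * f a) = f b" for f
    using b by (simp add: if_distrib[of "\<lambda>x. x * _"] cong: if_cong)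
  have e2: "(\<Sum>a<A. f a * ?D a c) = f c" for f
    using c by (simp add: if_distrib[of "\<lambda>x. _ * x"] cong: if_cong)
  have "(\<Sum>a<A. (\<Sum>y\<in>Y. q y a * q y b) * (\<Sum>y\<in>Y. q y a * q y c))
      = (\<Sum>a<A. \<Sum>y\<in>Y. \<Sum>y'\<in>Y. q y b * q y' c * (q y a * q y' a))"
    by (simp add: sum_product mult_ac)
  also have "\<dots> = (\<Sum>y\<in>Y. \<Sum>a<A. \<Sum>y'\<in>Y. q y b * q y' c * (q y a * q y' a))"
    by (rule sum.swap)
  also have "\<dots> = (\<Sum>y\<in>Y. \<Sum>y'\<in>Y. \<Sum>a<A. q y b * q y' c * (q y a * q y' a))"
    by (rule sum.cong[OF refl], rule sum.swap)
  also have "\<dots> = (\<Sum>y\<in>Y. \<Sum>y'\<in>Y. q y b * q y' c * (if y = y' then 2 else 0))"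
    by (intro sum.cong refl) (simp add: sum_distrib_left[symmetric] orth)
  also have "\<dots> = 2 * (\<Sum>y\<in>Y. q y b * q y c)"
    using Y by (simp add: if_distrib[of "\<lambda>x. _ * x"] sum_distrib_left mult_ac cong: if_cong)
  finally have quad: "(\<Sum>a<A. (\<Sum>y\<in>Y. q y a * q y b) * (\<Sum>y\<in>Y. q y a * q y c))
      = 2 * (\<Sum>y\<in>Y. q y b * q y c)" .
  have "(\<Sum>a<A. (?D a b - (\<Sum>y\<in>Y. q y a * q y b)) * (?D a c - (\<Sum>y\<in>Y. q y a * q y c)))
      = (\<Sum>a<A. ?D a b * ?D a c) - (\<Sum>a<A. ?D a b * (\<Sum>y\<in>Y. q y a * q y c))
        - (\<Sum>a<A. (\<Sum>y\<in>Y. q y a * q y b) * ?D a c)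
        + (\<Sum>a<A. (\<Sum>y\<in>Y. q y a * q y b) * (\<Sum>y\<in>Y. q y a * q y c))"
    unfolding sum_subtractf[symmetric] sum.distrib[symmetric]
    by (intro sum.cong refl) (simp add: algebra_simps)
  also have "\<dots> = ?D b c" unfolding e1 e2 quad by (simp add: mult_ac)
  finally show "(\<Sum>a<A. cnj (reflection q Y a b) * reflection q Y a c) = (if b = c then 1 else 0)"
    unfolding reflection_def complex_cnj_complex_of_real of_real_mult[symmetric] of_real_sum[symmetric]
    by (auto simp del: of_real_sum of_real_mult of_real_diff)
qed

lemma reflection_apply:
  assumes "b < A"
  shows "(\<Sum>c<A. reflection q Y b c * of_real (v c))
       = of_real (v b - (\<Sum>y\<in>Y. q y b * (\<Sum>c<A. q y c * v c)))"
proof -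
  have "(\<Sum>c<A. ((if b = c then 1 else 0) - (\<Sum>y\<in>Y. q y b * q y c)) * v c)
      = (\<Sum>c<A. (if b = c then 1 else 0) * v c) - (\<Sum>c<A. \<Sum>y\<in>Y. q y b * (q y c * v c))"
    unfolding sum_subtractf[symmetric]
    by (intro sum.cong refl) (simp add: left_diff_distrib sum_distrib_right mult.assoc)
  also have "(\<Sum>c<A. \<Sum>y\<in>Y. q y b * (q y c * v c)) = (\<Sum>y\<in>Y. q y b * (\<Sum>c<A. q y c * v c))"
    by (subst sum.swap) (simp add: sum_distrib_left)
  also have "(\<Sum>c<A. (if b = c then 1 else 0) * v c) = v b"
    using assms by (simp add: if_distrib[of "\<lambda>x. x * _"] cong: if_cong)
  finally show ?thesis
    unfolding reflection_def of_real_mult[symmetric] of_real_sum[symmetric] by (simp only:)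
qed


section \<open>From separating scans to an algorithm\<close>

text \<open>Follows the encoding of index pairs in \<open>compose\<close>; ancilla values, made of a
  stage and a branch, are encoded in the same way.\<close>

definition pairs :: "nat \<Rightarrow> nat set \<Rightarrow> nat set \<Rightarrow> nat set" where
  "pairs k X Y = (\<lambda>(a, b). a * k + b) ` (X \<times> Y)"

lemma mem_pairs_iff:
  assumes "Y \<subseteq> {..<k}"
  shows "x \<in> pairs k X Y \<longleftrightarrow> x div k \<in> X \<and> x mod k \<in> Y"
proof
  assume "x \<in> pairs k X Y"
  then show "x div k \<in> X \<and> x mod k \<in> Y" using assms by (auto simp: pairs_def)
next
  assume "x div k \<in> X \<and> x mod k \<in> Y"
  then show "x \<in> pairs k X Y"
    by (auto simp: pairs_def intro!: image_eqI[of _ _ "(x div k, x mod k)"])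
qed

lemma pairs_lessThan: "pairs k {..<n} {..<k} = {..<n * k}"
proof (cases "k = 0")
  case False
  then show ?thesis by (auto simp: mem_pairs_iff less_mult_imp_div_less div_less_iff_less_mult)
qed (auto simp: pairs_def)

lemma sum_pairs:
  fixes f g :: "nat \<Rightarrow> 'a::semiring_0"
  assumes "Y \<subseteq> {..<k}"
  shows "(\<Sum>x\<in>pairs k X Y. f (x div k) * g (x mod k)) = sum f X * sum g Y"
proof -
  have "inj_on (\<lambda>(a, b). a * k + b) (X \<times> Y)"
  proof (rule inj_onI, clarsimp)
    fix a b a' b' assume "b \<in> Y" "b' \<in> Y" and e: "a * k + b = a' * k + b'"
    then have b: "b < k" "b' < k" using assms by auto
    show "a = a' \<and> b = b'"
      using arg_cong[OF e, of "\<lambda>x. x div k"] arg_cong[OF e, of "\<lambda>x. x mod k"] b by simp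
  qed
  then have "(\<Sum>x\<in>pairs k X Y. f (x div k) * g (x mod k)) = (\<Sum>(a, b)\<in>X \<times> Y. f a * g b)"
    unfolding pairs_def using assms
    by (subst sum.reindex) (auto intro!: sum.cong simp: subset_iff)
  then show ?thesis by (simp add: sum.cartesian_product' sum_product)
qed

text \<open>Phase kickback: signs acquired by the registers in branch \<open>b\<close> become a
  factor of the amplitude of \<open>b\<close>, and the registers are left in a state independent of
  \<open>b\<close>.\<close>

lemma pstate_pull_scalars:
  "pstate m d A c (\<lambda>b j r. \<sigma> b j * \<phi> j r) = pstate m d A (\<lambda>b. c b * (\<Prod>j<m. \<sigma> b j)) (\<lambda>_. \<phi>)"
  by (auto simp: pstate_def prod.distrib intro!: ext)

text \<open>One scan of the word w: in branch b, the calls at the positions in T b go to the target.\<close>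

definition block :: "nat \<Rightarrow> (nat \<Rightarrow> nat set) \<Rightarrow> nat list \<Rightarrow> (nat \<times> nat \<times> nat set) list" where
  "block e T w = map (\<lambda>(i, t). (e, i, {b. t \<in> T b})) (zip w [0..<length w])"

lemma on_target_block: "on_target (block e T w) b e' = (if e' = e then nths w (T b) else [])"
proof -
  have "on_target (map (\<lambda>(i, t). (e, i, {b. t \<in> T b})) ps) b e'
      = (if e' = e then map fst (filter (\<lambda>p. snd p \<in> T b) ps) else [])" for ps
    by (induction ps) (auto simp: on_target_def)
  then show ?thesis by (simp add: block_def nths_def)
qed

text \<open>The calls of gate \<open>i\<close> are shared between target and dummy, so the dummy
  receives what the selected subsequence leaves over. As all its entries are \<open>i\<close>, only
  their number matters.\<close>

lemma on_dummy_block: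
  "on_dummy (block e T w) b i = replicate (count_list w i - count_list (nths w (T b)) i) i"
proof -
  have "on_dummy cs b i = replicate (length (on_dummy cs b i)) i" for cs
    by (rule replicate_eqI) (auto simp: on_dummy_def)
  moreover have "length (on_dummy (map (\<lambda>(i, t). (e, i, {b. t \<in> T b})) ps) b i)
      + count_list (map fst (filter (\<lambda>p. snd p \<in> T b) ps)) i = count_list (map fst ps) i" for ps
    by (induction ps) (auto simp: on_dummy_def)
  from this[of "zip w [0..<length w]"]
  have "length (on_dummy (block e T w) b i) = count_list w i - count_list (nths w (T b)) i"
    by (simp add: block_def nths_def)
  ultimately show ?thesis by metis
qed

lemma on_target_concat: "on_target (concat css) b e = concat (map (\<lambda>cs. on_target cs b e) css)"
  by (induction css) (auto simp: on_target_def)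

lemma on_dummy_concat: "on_dummy (concat css) b i = concat (map (\<lambda>cs. on_dummy cs b i) css)"
  by (induction css) (auto simp: on_dummy_def)

lemma count_list_distinct: "distinct xs \<Longrightarrow> count_list xs i = (if i \<in> set xs then 1 else 0)"
  by (induction xs) auto

lemma concat_map_single:
  "concat (map (\<lambda>e'. if e = e' then l e' else []) [0..<N]) = (if e < N then l e else [])"
  by (induction N) auto

text \<open>All scans are run on disjoint targets but with common dummies. Every product uses each gate
  exactly once, so in all branches the dummies end in the same state and do not decohere the
  superposition.\<close>

lemma scans_solve:
  assumes P: "wf_hpp P" and d: "1 \<le> d"
    and ok: "\<forall>s\<in>set es. scan_ok P s" and sep: "separates P (set es)"
  shows "\<exists>Q. wf_alg (ngates P) d Q \<and> solves P d Q \<and> num_queries Q = (\<Sum>s\<leftarrow>es. length (word s))"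
proof -
  define N where "N = length es"
  define n where "n = ngates P"
  define K where "K = nprods P"
  define X where "X e = branches (es ! e)" for e
  define w where "w e = word (es ! e)" for e
  have oke: "scan_ok P (es ! e)" if "e < N" for e using ok that by (auto simp: N_def)
  have X: "X e \<noteq> {}" "X e \<subseteq> {..<K}" "finite (X e)" if "e < N" for e
    using oke[OF that] by (auto simp: scan_ok_def X_def K_def intro: finite_subset)
  have "\<forall>e x. \<exists>T. e < N \<longrightarrow> x \<in> X e \<longrightarrow>
      order P x = pre (es ! e) @ nths (w e) T @ post (es ! e)"
    using oke unfolding scan_ok_def X_def w_def subseq_conv_nths by metis
  then obtain T where T: "\<And>e x. e < N \<Longrightarrow> x \<in> X e \<Longrightarrow>
      order P x = pre (es ! e) @ nths (w e) (T e x) @ post (es ! e)"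
    by metis
  \<comment> \<open>An element of \<open>Z\<close> picks a branch in every scan, so that all scans
    share one ancilla.\<close>
  define Z where "Z = PiE {..<N} X"
  define A where "A = card Z"
  have Z: "finite Z" "Z \<noteq> {}"
    using X by (auto simp: Z_def PiE_eq_empty_iff intro: finite_PiE)
  then have A: "0 < A" by (simp add: A_def card_gt_0_iff)
  obtain \<zeta> where \<zeta>: "bij_betw \<zeta> {..<A} Z"
    using ex_bij_betw_nat_finite[OF Z(1)] by (auto simp: A_def atLeast0LessThan)
  \<comment> \<open>Only \<open>b mod A\<close> enters, so the routing of calls ignores the
    stage.\<close>
  define x where "x b e = \<zeta> (b mod A) e" for b e
  have xX: "x b e \<in> X e" if "e < N" for b e
  proof -
    have "\<zeta> (b mod A) \<in> Z" using \<zeta> A by (auto simp: bij_betw_def)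
    then show ?thesis using that by (auto simp: Z_def x_def)
  qed
  have XP: "x b e < nprods P" if "e < N" for b e
    using xX[OF that, of b] X(2)[OF that] by (auto simp: K_def)
  define cs where "cs = concat (map (\<lambda>e. block e (\<lambda>b. T e (x b e)) (w e)) [0..<N])"
  have target: "on_target cs b e = nths (w e) (T e (x b e))" if "e < N" for b e
    using that by (simp add: cs_def on_target_concat o_def on_target_block concat_map_single)
  \<comment> \<open>The parts before and after the window are common to the branches of a scan, and
    each order contains a gate at most once and the same gates, so all windows of a scan contain a
    given gate equally often.\<close>
  have "on_dummy cs b i = on_dummy cs 0 i" for b i
  proof -
    have "count_list (nths (w e) (T e (x b e))) i = count_list (nths (w e) (T e (x 0 e))) i"
      if e: "e < N" for e
    proof -
      have "count_list (order P (x b e)) i = count_list (order P (x 0 e)) i"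
        using P XP[OF e, of b] XP[OF e, of 0]
        by (simp add: wf_hpp_def count_list_distinct)
      then show ?thesis unfolding T[OF e xX[OF e]] by simp
    qed
    then show ?thesis
      by (auto simp: cs_def on_dummy_concat o_def on_dummy_block intro!: arg_cong[of _ _ concat])
  qed
  then obtain D where dummy: "\<And>b i. on_dummy cs b i = D i"
    by metis
  have cs_ok: "\<forall>(e, i, S)\<in>set cs. e < N \<and> i < n"
  proof -
    have "e < N \<and> i < n" if "(e, i, S) \<in> set cs" for e i S
    proof -
      from that obtain e' where "e' < N" "(e, i, S) \<in> set (block e' (\<lambda>b. T e' (x b e')) (w e'))"
        by (auto simp: cs_def)
      then have "e = e'" "i \<in> set (w e')" by (auto simp: block_def dest: set_zip_leftD)
      then show ?thesis using oke[OF \<open>e' < N\<close>] \<open>e' < N\<close> by (auto simp: scan_ok_def w_def n_def)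
    qed
    then show ?thesis by auto
  qed

  \<comment> \<open>An ancilla value b encodes a stage b div A (0: initial, 1: superposed, y + 2: answer y)
    and a branch b mod A, i.e. a simultaneous choice of one product per scan.\<close>
  define R where "R = K + 2"
  have R: "1 < R" "y < K \<Longrightarrow> y + 2 < R" for y by (auto simp: R_def)
  define A' where "A' = R * A"
  define a0 where "a0 = 1 / sqrt (real A)"
  have a0: "a0 * a0 * real A = 1" using A by (simp add: a0_def)
  define vv where "vv y z = a0 * (\<Prod>e<N. real_of_int (hsign P (x z e) y))" for y z
  \<comment> \<open>Summing over all of \<open>Z\<close> gives a product over the scans. For
    \<open>y = y'\<close> every factor of a summand is 1; otherwise a separating scan contributes
    the factor 0.\<close>
  have gram: "(\<Sum>z<A. vv y z * vv y' z) = (if y = y' then 1 else 0)" if y: "y < K" "y' < K" for y y'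
  proof -
    let ?s = "\<lambda>x. real_of_int (hsign P x y * hsign P x y')"
    have "(\<Sum>z<A. vv y z * vv y' z) = a0 * a0 * (\<Sum>z<A. \<Prod>e<N. ?s (\<zeta> z e))"
      by (simp add: vv_def sum_distrib_left prod.distrib x_def mult_ac)
    also have "(\<Sum>z<A. \<Prod>e<N. ?s (\<zeta> z e)) = (\<Sum>f\<in>Z. \<Prod>e<N. ?s (f e))"
      by (rule sum.reindex_bij_betw[OF \<zeta>])
    finally have *: "(\<Sum>z<A. vv y z * vv y' z) = a0 * a0 * (\<Sum>f\<in>Z. \<Prod>e<N. ?s (f e))" .
    show ?thesis
    proof (cases "y = y'")
      case True
      have "?s (f e) = 1" if "f \<in> Z" "e < N" for f e
      proof -
        have "f e < K" using that X(2)[OF that(2)] by (auto simp: Z_def PiE_def Pi_def)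
        then have "hsign P (f e) y = 1 \<or> hsign P (f e) y = -1" using P y by (auto simp: wf_hpp_def K_def)
        then show ?thesis using True by auto
      qed
      then have "(\<Sum>f\<in>Z. \<Prod>e<N. ?s (f e)) = (\<Sum>f\<in>Z. 1)"
        by (intro sum.cong refl prod.neutral) auto
      then show ?thesis using a0 True unfolding * by (simp add: A_def)
    next
      case False
      then obtain s where s: "s \<in> set es" "(\<Sum>x\<in>branches s. hsign P x y * hsign P x y') = 0"
        using sep y by (auto simp: separates_def K_def)
      then obtain e where e: "e < N" "es ! e = s" by (auto simp: in_set_conv_nth N_def)
      have "(\<Sum>f\<in>Z. \<Prod>e<N. ?s (f e)) = (\<Prod>e<N. \<Sum>x\<in>X e. ?s x)"
        unfolding Z_def by (rule prod_sum_PiE[symmetric]) (use X in auto)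
      also have "\<dots> = 0"
      proof (rule prod_zero)
        have "(\<Sum>x\<in>X e. ?s x) = 0"
          using s(2) e(2) unfolding X_def of_int_sum[symmetric] by simp
        then show "\<exists>e\<in>{..<N}. (\<Sum>x\<in>X e. ?s x) = 0" using e(1) by auto
      qed simp
      finally show ?thesis using False unfolding * by simp
    qed
  qed
  have sum_anc: "(\<Sum>b<A'. f (b div A) * g (b mod A)) = (\<Sum>\<rho><R. f \<rho>) * (\<Sum>z<A. g z)"
    for f g :: "nat \<Rightarrow> real"
    unfolding A'_def pairs_lessThan[symmetric] by (rule sum_pairs) simp
  define v where "v b = (if b div A = 1 then a0 else 0)" for b
  define e0 :: "nat \<Rightarrow> real" where "e0 b = (if b = 0 then 1 else 0)" for b
  have A'0: "0 < A'" using A R(1) by (simp add: A'_def)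
  \<comment> \<open>The reflection along this difference exchanges the initial ancilla state
    \<open>e0\<close> with the uniform superposition \<open>v\<close> in stage 1. The one-element
    index type makes it an instance of \<open>reflection\<close>.\<close>
  define q0 where "q0 (u::unit) b = e0 b - v b" for u b
  \<comment> \<open>With these coefficients \<open>q y\<close> is the vector \<open>vv y\<close>
    placed in stage 1 minus the same vector placed in stage \<open>y + 2\<close>. Reflecting along
    all \<open>q y\<close> at once writes the answer into the stage.\<close>
  define I where "I \<rho> y = (if \<rho> = 1 then 1 else if \<rho> = y + 2 then -1 else 0 :: real)" for \<rho> y :: nat
  define q where "q y b = I (b div A) y * vv y (b mod A)" for y b
  have e0_sum: "(\<Sum>b<A'. e0 b * f b) = f 0" for f
    using A'0 by (simp add: e0_def if_distrib[of "\<lambda>x. x * _"] cong: if_cong)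
  have v0: "v 0 = 0" by (simp add: v_def)
  have vnorm: "(\<Sum>b<A'. v b * v b) = 1"
  proof -
    have "(\<Sum>b<A'. v b * v b) = (\<Sum>b<A'. (if b div A = 1 then 1 else 0) * (\<lambda>_. a0 * a0) (b mod A))"
      by (intro sum.cong) (auto simp: v_def)
    also have "\<dots> = (\<Sum>\<rho><R. if \<rho> = 1 then 1 else 0) * (\<Sum>z<A. a0 * a0)"
      by (rule sum_anc)
    also have "\<dots> = 1" using a0 R(1) by (simp add: mult_ac)
    finally show ?thesis .
  qed
  have q0_norm: "(\<Sum>b<A'. q0 u b * q0 u' b) = (if u = u' then 2 else 0)" for u u'
  proof -
    have "(\<Sum>b<A'. q0 u b * q0 u' b) = (\<Sum>b<A'. e0 b * (e0 b - 2 * v b)) + (\<Sum>b<A'. v b * v b)"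
      unfolding sum.distrib[symmetric] by (intro sum.cong) (auto simp: q0_def algebra_simps)
    then show ?thesis unfolding e0_sum vnorm by (simp add: v0 e0_def)
  qed
  have q_vv: "(\<Sum>b<A'. q y b * (J (b div A) * vv y' (b mod A)))
      = (if y = y' then \<Sum>\<rho><R. I \<rho> y * J \<rho> else 0)" if "y < K" "y' < K" for y y' J
  proof -
    have "(\<Sum>b<A'. q y b * (J (b div A) * vv y' (b mod A)))
        = (\<Sum>b<A'. (\<lambda>\<rho>. I \<rho> y * J \<rho>) (b div A) * (\<lambda>z. vv y z * vv y' z) (b mod A))"
      by (intro sum.cong refl) (simp add: q_def)
    also have "\<dots> = (\<Sum>\<rho><R. I \<rho> y * J \<rho>) * (\<Sum>z<A. vv y z * vv y' z)"
      by (rule sum_anc)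
    finally show ?thesis using that by (simp add: gram)
  qed
  have I_sum: "(\<Sum>\<rho><R. I \<rho> y * J \<rho>) = J 1 - J (y + 2)" if "y < K" for y J
  proof -
    have "(\<Sum>\<rho><R. I \<rho> y * J \<rho>)
        = (\<Sum>\<rho><R. (if \<rho> = 1 then J \<rho> else 0)) - (\<Sum>\<rho><R. (if \<rho> = y + 2 then J \<rho> else 0))"
      unfolding sum_subtractf[symmetric] by (intro sum.cong) (auto simp: I_def)
    then show ?thesis using that R by simp
  qed
  have q_orth: "(\<Sum>b<A'. q y b * q y' b) = (if y = y' then 2 else 0)" if "y < K" "y' < K" for y y'
    unfolding q_def[of y'] q_vv[OF that, of "\<lambda>\<rho>. I \<rho> y'"] I_sum[OF that(1), of "\<lambda>\<rho>. I \<rho> y'"]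
    by (simp add: I_def)

  define prog where "prog = Fixed (anc_op (reflection q0 UNIV)) # concat (map (call N) (rev cs))
      @ [Fixed (anc_op (reflection q {..<K}))]"
  define Q where "Q = \<lparr>nregs = N + n, ancdim = A', instrs = prog, outmap = (\<lambda>(as, b). b div A - 2)\<rparr>"
  have "wf_alg n d Q"
  proof -
    have u1: "unitary_on (basis (N + n) d A') (anc_op (reflection q0 UNIV))"
      by (rule unitary_reflection) (simp_all only: finite q0_norm)
    have u2: "unitary_on (basis (N + n) d A') (anc_op (reflection q {..<K}))"
      by (rule unitary_reflection) (auto simp: q_orth)
    have u3: "wf_instr n (N + n) d A' ins" if ins: "ins \<in> set (call N (e, i, S))" and "(e, i, S) \<in> set cs"
      for e i S ins
    proof -
      have "e < N" "i < n" using cs_ok that by auto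
      then have "unitary_on (basis (N + n) d A') (cswap S e (N + i))" by (intro unitary_cswap) auto
      then show ?thesis using ins \<open>i < n\<close> by (auto simp: call_def wf_instr_def)
    qed
    have "wf_instr n (N + n) d A' ins" if "ins \<in> set prog" for ins
      using that u1 u2 u3 by (auto simp: prog_def wf_instr_def)
    then show ?thesis using A'0 by (simp add: wf_alg_def Q_def)
  qed
  moreover have "num_queries Q = (\<Sum>s\<leftarrow>es. length (word s))"
  proof -
    have "length (filter is_query (concat (map (call N) cs))) = length cs" for cs
      by (induction cs) (auto simp: call_def is_query_def)
    then have "num_queries Q = length (rev cs)"
      by (simp add: num_queries_def Q_def prog_def is_query_def)
    also have "\<dots> = (\<Sum>e\<leftarrow>[0..<N]. length (w e))"
      by (simp add: cs_def length_concat o_def block_def)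
    also have "map (\<lambda>e. length (w e)) [0..<N] = map (\<lambda>s. length (word s)) es"
      by (rule nth_equalityI) (auto simp: w_def N_def)
    finally show ?thesis .
  qed
  moreover have "solves P d Q"
    unfolding solves_def
  proof (intro allI impI ballI)
    fix U y \<beta>
    assume pr: "promise P d U y" and \<beta>: "\<beta> \<in> basis (nregs Q) d (ancdim Q)"
      and nz: "final_state d Q U \<beta> \<noteq> 0"
    have y: "y < K" using pr by (simp add: promise_def K_def)
    let ?ap = "apply_instr (N + n) d A' U"
    let ?ps = "pstate (N + n) d A'"
    let ?u = "\<lambda>r::nat. if r = 0 then 1 else 0 :: complex"
    \<comment> \<open>All registers start in \<open>?u\<close>. By the promise the target of scan
      \<open>e\<close> ends in a common vector \<open>\<mu> e\<close>, up to the sign of its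
      branch.\<close>
    have "\<forall>e. \<exists>\<mu>. e < N \<longrightarrow> (\<forall>x\<in>X e. \<forall>r<d.
        run d U (nths (w e) (T e x)) ?u r = of_int (hsign P x y) * \<mu> r)"
    proof
      fix e
      show "\<exists>\<mu>. e < N \<longrightarrow> (\<forall>x\<in>X e. \<forall>r<d.
          run d U (nths (w e) (T e x)) ?u r = of_int (hsign P x y) * \<mu> r)"
      proof (cases "e < N")
        case True
        then show ?thesis
          using promise_window[OF P pr X(2)[OF True, unfolded K_def] X(1)[OF True] T[OF True]] by simp
      qed simp
    qed
    then obtain \<mu> where \<mu>: "\<And>e x r. e < N \<Longrightarrow> x \<in> X e \<Longrightarrow> r < d \<Longrightarrow>
        run d U (nths (w e) (T e x)) ?u r = of_int (hsign P x y) * \<mu> e r"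
      by metis
    define \<phi> where "\<phi> j r = (if j < N then \<mu> j r else run d U (D (j - N)) ?u r)" for j r
    define \<sigma> :: "nat \<Rightarrow> nat \<Rightarrow> complex" where
      "\<sigma> b j = (if j < N then of_int (hsign P (x b j) y) else 1)" for b j
    have s1: "init_state (N + n) = ?ps (\<lambda>b. of_real (e0 b)) (\<lambda>_ _. ?u)"
      using d A'0 by (subst init_state_pstate[of d A']) (auto simp: e0_def intro: pstate_cong)
    have s2: "?ap (Fixed (anc_op (reflection q0 UNIV))) (init_state (N + n))
        = ?ps (\<lambda>b. of_real (v b)) (\<lambda>_ _. ?u)"
    proof -
      have "(\<Sum>c<A'. q0 u c * e0 c) = 1" for u
        using e0_sum[of "q0 u"] by (simp add: mult.commute q0_def v0 e0_def)
      then have "e0 b - (\<Sum>u\<in>UNIV. q0 u b * (\<Sum>c<A'. q0 u c * e0 c)) = v b" for b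
        by (simp add: q0_def UNIV_unit)
      then show ?thesis
        unfolding s1 apply_anc_op_pstate by (intro pstate_cong) (auto simp: reflection_apply)
    qed
    have s3: "fold ?ap (concat (map (call N) (rev cs))) (?ps (\<lambda>b. of_real (v b)) (\<lambda>_ _. ?u))
        = ?ps (\<lambda>b. of_real ((if b div A = 1 then 1 else 0) * vv y (b mod A))) (\<lambda>_. \<phi>)"
    proof -
      have "fold ?ap (concat (map (call N) (rev cs))) (?ps (\<lambda>b. of_real (v b)) (\<lambda>_ _. ?u))
         = ?ps (\<lambda>b. of_real (v b)) (\<lambda>b j. run d U (if j < N then on_target cs b j else on_dummy cs b (j - N)) ?u)"
        by (rule fold_calls_pstate[OF cs_ok])
      also have "\<dots> = ?ps (\<lambda>b. of_real (v b)) (\<lambda>b j r. \<sigma> b j * \<phi> j r)"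
        by (rule pstate_cong) (auto simp: \<sigma>_def \<phi>_def target \<mu> xX dummy)
      also have "\<dots> = ?ps (\<lambda>b. of_real (v b) * (\<Prod>j<N + n. \<sigma> b j)) (\<lambda>_. \<phi>)"
        by (rule pstate_pull_scalars)
      also have "\<dots> = ?ps (\<lambda>b. of_real ((if b div A = 1 then 1 else 0) * vv y (b mod A))) (\<lambda>_. \<phi>)"
      proof (rule pstate_cong[OF refl])
        fix b
        have "(\<Prod>j<N + n. \<sigma> b j) = (\<Prod>j<N. \<sigma> b j)"
          by (rule prod.mono_neutral_right) (auto simp: \<sigma>_def)
        also have "\<dots> = of_real (\<Prod>j<N. real_of_int (hsign P (x b j) y))"
          by (simp add: \<sigma>_def)
        finally show "of_real (v b) * (\<Prod>j<N + n. \<sigma> b j)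
            = of_real ((if b div A = 1 then 1 else 0) * vv y (b mod A))"
          by (auto simp: v_def vv_def x_def)
      qed
      finally show ?thesis .
    qed
    \<comment> \<open>Of the vectors \<open>q y'\<close> only \<open>q y\<close> overlaps with the
      state, with inner product 1; subtracting it cancels stage 1 and leaves \<open>vv y\<close> in
      stage \<open>y + 2\<close>.\<close>
    have s4: "?ap (Fixed (anc_op (reflection q {..<K})))
          (?ps (\<lambda>b. of_real ((if b div A = 1 then 1 else 0) * vv y (b mod A))) (\<lambda>_. \<phi>))
        = ?ps (\<lambda>b. of_real ((if b div A = y + 2 then 1 else 0) * vv y (b mod A))) (\<lambda>_. \<phi>)"
    proof -
      let ?J = "\<lambda>\<rho>. if \<rho> = 1 then 1 else 0 :: real"
      have "(\<Sum>c<A'. q y' c * (?J (c div A) * vv y (c mod A))) = (if y' = y then 1 else 0)"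
        if "y' < K" for y'
        using q_vv[OF that y, of ?J] I_sum[OF that, of ?J] by (simp only:) simp
      then have "(\<Sum>y'<K. q y' b * (\<Sum>c<A'. q y' c * (?J (c div A) * vv y (c mod A))))
          = (\<Sum>y'<K. if y' = y then q y b else 0)" for b
        by (intro sum.cong refl) auto
      then have "?J (b div A) * vv y (b mod A)
            - (\<Sum>y'<K. q y' b * (\<Sum>c<A'. q y' c * (?J (c div A) * vv y (c mod A))))
          = (if b div A = y + 2 then 1 else 0) * vv y (b mod A)" for b
        using y by (simp add: q_def I_def)
      then show ?thesis
        unfolding apply_anc_op_pstate
        by (intro pstate_cong refl) (simp only: reflection_apply)
    qed
    have "final_state d Q U = ?ps (\<lambda>b. of_real ((if b div A = y + 2 then 1 else 0) * vv y (b mod A))) (\<lambda>_. \<phi>)"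
      by (simp add: final_state_def Q_def prog_def s2 s3 s4 del: of_real_mult One_nat_def)
    then show "outmap Q \<beta> = y"
      using nz by (cases \<beta>) (auto simp: pstate_def Q_def split: if_splits)
  qed
  ultimately show ?thesis unfolding n_def by blast
qed


section \<open>Plans and their composition\<close>

text \<open>A call of g in the word which serves the gate g in all branches: it is here that a whole
  superposition of products can be substituted for g.\<close>

definition scan_pivot :: "hpp \<Rightarrow> scan \<Rightarrow> nat \<Rightarrow> bool" where
  "scan_pivot P s g \<longleftrightarrow> (\<exists>\<alpha> \<beta>. word s = \<alpha> @ g # \<beta> \<and>
     (\<forall>x\<in>branches s. \<exists>p q. order P x = pre s @ p @ g # q @ post s \<and> subseq p \<alpha> \<and> subseq q \<beta>))"

text \<open>The first scan compares complete products, so that it can be grafted into another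
  problem in place of a gate. Distinct gates have their pivots in distinct scans, so that rewriting
  the scan of one gate leaves the pivots of the others available.\<close>

definition plan :: "hpp \<Rightarrow> scan list \<Rightarrow> bool" where
  "plan P es \<longleftrightarrow> es \<noteq> [] \<and> (\<forall>s\<in>set es. scan_ok P s) \<and>
     pre (hd es) = [] \<and> post (hd es) = [] \<and> separates P (set es) \<and>
     (\<exists>idx. inj_on idx {..<ngates P} \<and>
        (\<forall>g<ngates P. idx g < length es \<and> scan_pivot P (es ! idx g) g))"

text \<open>The weight of a gate stands for the number of calls that one use of it takes once other
  problems have been substituted.\<close>

definition cost :: "(nat \<Rightarrow> nat) \<Rightarrow> nat list \<Rightarrow> nat" where
  "cost \<omega> l = sum_list (map \<omega> l)"

lemma cost_simps [simp]:
  "cost \<omega> [] = 0" "cost \<omega> (i # l) = \<omega> i + cost \<omega> l" "cost \<omega> (l @ l') = cost \<omega> l + cost \<omega> l'"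
  by (simp_all add: cost_def)

definition total_cost :: "(nat \<Rightarrow> nat) \<Rightarrow> scan list \<Rightarrow> nat" where
  "total_cost \<omega> es = (\<Sum>s\<leftarrow>es. cost \<omega> (word s))"

text \<open>The renumbering of gates performed by compose.\<close>

definition plug :: "nat \<Rightarrow> nat \<Rightarrow> nat list \<Rightarrow> nat list \<Rightarrow> nat list" where
  "plug m g l2 l = concat (map (\<lambda>i. if i = g then map ((+) (m - 1)) l2 else [if i < g then i else i - 1]) l)"

lemma plug_simps [simp]:
  "plug m g l2 [] = []"
  "plug m g l2 (i # l) = (if i = g then map ((+) (m - 1)) l2 else [if i < g then i else i - 1]) @ plug m g l2 l"
  "plug m g l2 (l @ l') = plug m g l2 l @ plug m g l2 l'"
  by (simp_all add: plug_def)

lemma plug_avoiding: "g \<notin> set l \<Longrightarrow> plug m g l2 l = map (\<lambda>i. if i < g then i else i - 1) l"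
  by (induction l) auto

lemma subseq_plug: "subseq l l' \<Longrightarrow> subseq (plug m g l2 l) (plug m g l2 l')"
proof (induction rule: list_emb.induct)
  case (list_emb_Cons xs ys y)
  show ?case unfolding plug_simps(2) by (rule list_emb_append2[OF list_emb_Cons(2)])
next
  case (list_emb_Cons2 x y xs ys)
  then show ?case unfolding plug_simps(2) by (intro list_emb_append_mono) auto
qed simp

lemma set_plug:
  "set l \<subseteq> {..<m} \<Longrightarrow> set l2 \<subseteq> {..<n2} \<Longrightarrow> g < m \<Longrightarrow> set (plug m g l2 l) \<subseteq> {..<m + n2 - 1}"
proof (induction l)
  case (Cons i l)
  have "set (if i = g then map ((+) (m - 1)) l2 else [if i < g then i else i - 1]) \<subseteq> {..<m + n2 - 1}"
    using Cons.prems by auto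
  moreover have "set (plug m g l2 l) \<subseteq> {..<m + n2 - 1}" using Cons by simp
  ultimately show ?case unfolding plug_simps(2) set_append by (rule Un_least)
qed simp

lemma cost_plug:
  "cost \<omega> (plug m g l2 l)
     = cost (\<lambda>i. if i = g then cost (\<lambda>j. \<omega> (m - 1 + j)) l2 else \<omega> (if i < g then i else i - 1)) l"
  by (induction l) (simp_all add: cost_def o_def)

section \<open>Scans of a composite problem\<close>

locale composition =
  fixes P1 P2 :: hpp and g :: nat
  assumes wf1: "wf_hpp P1" and wf2: "wf_hpp P2" and g: "g < ngates P1"
begin

abbreviation "m \<equiv> ngates P1"
abbreviation "n2 \<equiv> ngates P2"
abbreviation "k2 \<equiv> nprods P2"
abbreviation "R \<equiv> Defs.compose P1 g P2"
abbreviation "ren i \<equiv> if i < g then i else i - (1::nat)"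
abbreviation "sh \<equiv> (+) (m - 1)"
abbreviation "fresh \<equiv> plug m g (order P2 0)"

lemma R_simps:
  "ngates R = m + n2 - 1"
  "nprods R = nprods P1 * k2"
  "order R x = plug m g (order P2 (x mod k2)) (order P1 (x div k2))"
  "hsign R x y = hsign P1 (x div k2) (y div k2) * hsign P2 (x mod k2) (y mod k2)"
  by (simp_all add: Defs.compose_def Let_def plug_def)

lemma k2_pos: "0 < k2" and k1_pos: "0 < nprods P1"
  using wf1 wf2 by (auto simp: wf_hpp_def)

lemma div_mod_less: "x < nprods R \<Longrightarrow> x div k2 < nprods P1" "x mod k2 < k2"
  using k2_pos by (auto simp: R_simps less_mult_imp_div_less)

lemma order1: "x < nprods P1 \<Longrightarrow> distinct (order P1 x)" "x < nprods P1 \<Longrightarrow> set (order P1 x) = {..<m}"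
  using wf1 by (auto simp: wf_hpp_def)

lemma order2: "x < k2 \<Longrightarrow> distinct (order P2 x)" "x < k2 \<Longrightarrow> set (order P2 x) = {..<n2}"
  using wf2 by (auto simp: wf_hpp_def)

lemma wf_compose: "wf_hpp R"
proof -
  have "distinct (order R x) \<and> set (order R x) = {0..<ngates R}" if x: "x < nprods R" for x
  proof -
    let ?l = "order P1 (x div k2)" and ?l2 = "order P2 (x mod k2)"
    have l: "distinct ?l" "set ?l = {..<m}" using order1 div_mod_less(1)[OF x] by auto
    have l2: "distinct ?l2" "set ?l2 = {..<n2}" using order2 div_mod_less(2) by auto
    obtain a b where ab: "?l = a @ g # b" using g l(2) split_list[of g ?l] by auto
    have gab: "g \<notin> set a" "g \<notin> set b" using l(1) ab by auto
    have "length ?l = m" using l distinct_card[of ?l] by simp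
    moreover have "length ?l2 = n2" using l2 distinct_card[of ?l2] by simp
    ultimately have len: "length (order R x) = m + n2 - 1"
      unfolding R_simps ab by (simp add: plug_avoiding gab)
    have sub: "set (order R x) \<subseteq> {..<m + n2 - 1}"
      unfolding R_simps by (rule set_plug) (use l l2 g in auto)
    have "i \<in> set (order R x)" if i: "i < m + n2 - 1" for i
    proof (cases "i < m - 1")
      case False
      then have "i - (m - 1) \<in> set ?l2" using i l2 by auto
      then have "i \<in> set (map sh ?l2)" using False by (auto intro!: image_eqI[of _ _ "i - (m - 1)"])
      then show ?thesis unfolding R_simps ab by simp
    next
      case True
      define j where "j = (if i < g then i else i + 1)"
      have "i + 1 < m" using True by linarith
      then have "j < m" "j \<noteq> g" "i = ren j" by (simp_all add: j_def)
      moreover have "{..<m} = insert g (set a \<union> set b)" unfolding l(2)[symmetric] ab by auto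
      ultimately have "i \<in> ren ` (set a \<union> set b)" by blast
      then show ?thesis unfolding R_simps ab by (auto simp: plug_avoiding gab)
    qed
    then have "set (order R x) = {0..<ngates R}" using sub by (auto simp: R_simps(1))
    then show ?thesis using len card_distinct[of "order R x"] by (simp add: R_simps(1))
  qed
  moreover have "hsign R x y = 1 \<or> hsign R x y = -1" if x: "x < nprods R" and y: "y < nprods R" for x y
  proof -
    have "hsign P1 (x div k2) (y div k2) \<in> {1, -1}" "hsign P2 (x mod k2) (y mod k2) \<in> {1, -1}"
      using wf1 wf2 div_mod_less(1)[OF x] div_mod_less(1)[OF y] div_mod_less(2) by (auto simp: wf_hpp_def)
    then show ?thesis by (auto simp: R_simps(4))
  qed
  moreover have "1 \<le> nprods R" using k1_pos k2_pos by (simp add: R_simps(2) Suc_le_eq)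
  ultimately show ?thesis unfolding wf_hpp_def by blast
qed

text \<open>A scan of \<open>P1\<close>, with the choice in \<open>P2\<close> fixed to its product
  0.\<close>

definition fill :: "scan \<Rightarrow> scan" where
  "fill s = \<lparr>pre = fresh (pre s), branches = pairs k2 (branches s) {0},
             word = fresh (word s), post = fresh (post s)\<rparr>"

text \<open>Both choices vary: the call of \<open>g\<close> between \<alpha> and \<beta> makes room
  for the word of a scan of complete products of \<open>P2\<close>.\<close>

definition graft :: "scan \<Rightarrow> nat list \<Rightarrow> nat list \<Rightarrow> scan \<Rightarrow> scan" where
  "graft s \<alpha> \<beta> r = \<lparr>pre = fresh (pre s), branches = pairs k2 (branches s) (branches r),
             word = fresh \<alpha> @ map sh (word r) @ fresh \<beta>, post = fresh (post s)\<rparr>"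

text \<open>A scan of \<open>P2\<close>, with the choice in \<open>P1\<close> fixed to its product
  0; \<open>p\<close> and \<open>q\<close> are the parts of that product around \<open>g\<close>,
  which are common to all branches.\<close>

definition lift :: "nat list \<Rightarrow> nat list \<Rightarrow> scan \<Rightarrow> scan" where
  "lift p q s = \<lparr>pre = fresh p @ map sh (pre s), branches = pairs k2 {0} (branches s),
             word = map sh (word s), post = map sh (post s) @ fresh q\<rparr>"

lemma pairs_ok:
  assumes "X \<noteq> {}" "X \<subseteq> {..<nprods P1}" "Y \<noteq> {}" "Y \<subseteq> {..<k2}"
  shows "pairs k2 X Y \<noteq> {}" "pairs k2 X Y \<subseteq> {..<nprods R}"
    "x \<in> pairs k2 X Y \<longleftrightarrow> x div k2 \<in> X \<and> x mod k2 \<in> Y"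
proof -
  show "pairs k2 X Y \<noteq> {}" using assms by (auto simp: pairs_def)
  show "pairs k2 X Y \<subseteq> {..<nprods R}"
    unfolding R_simps pairs_lessThan[symmetric] using assms by (auto simp: pairs_def)
  show "x \<in> pairs k2 X Y \<longleftrightarrow> x div k2 \<in> X \<and> x mod k2 \<in> Y"
    by (rule mem_pairs_iff) (use assms in auto)
qed

lemma set_fresh: "set l \<subseteq> {..<m} \<Longrightarrow> set (fresh l) \<subseteq> {..<ngates R}"
  unfolding R_simps by (rule set_plug) (use g order2 k2_pos in auto)

lemma fill_ok:
  assumes "scan_ok P1 s"
  shows "scan_ok R (fill s)"
proof -
  have s: "branches s \<noteq> {}" "branches s \<subseteq> {..<nprods P1}" "set (word s) \<subseteq> {..<m}"
    using assms by (auto simp: scan_ok_def)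
  note p = pairs_ok[OF s(1,2), of "{0}"]
  have "\<exists>q. order R x = pre (fill s) @ q @ post (fill s) \<and> subseq q (word (fill s))"
    if x: "x \<in> branches (fill s)" for x
  proof -
    have "x div k2 \<in> branches s" "x mod k2 = 0" using x p k2_pos by (auto simp: fill_def)
    moreover then obtain q where "order P1 (x div k2) = pre s @ q @ post s" "subseq q (word s)"
      using assms by (auto simp: scan_ok_def)
    ultimately show ?thesis
      by (intro exI[of _ "fresh q"]) (simp add: R_simps fill_def subseq_plug)
  qed
  then show ?thesis using p k2_pos set_fresh[OF s(3)] by (auto simp: scan_ok_def fill_def)
qed

lemma fill_pivot:
  assumes "scan_ok P1 s" "scan_pivot P1 s i" "i \<noteq> g"
  shows "scan_pivot R (fill s) (ren i)"
proof -
  have s: "branches s \<noteq> {}" "branches s \<subseteq> {..<nprods P1}"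
    using assms by (auto simp: scan_ok_def)
  note p = pairs_ok[OF s, of "{0}"]
  obtain \<alpha> \<beta> where w: "word s = \<alpha> @ i # \<beta>"
    and o1: "\<forall>x\<in>branches s. \<exists>p q. order P1 x = pre s @ p @ i # q @ post s \<and> subseq p \<alpha> \<and> subseq q \<beta>"
    using assms(2) by (auto simp: scan_pivot_def)
  have "\<exists>p q. order R x = pre (fill s) @ p @ ren i # q @ post (fill s) \<and>
      subseq p (fresh \<alpha>) \<and> subseq q (fresh \<beta>)" if x: "x \<in> branches (fill s)" for x
  proof -
    have "x div k2 \<in> branches s" "x mod k2 = 0" using x p k2_pos by (auto simp: fill_def)
    moreover then obtain p q where "order P1 (x div k2) = pre s @ p @ i # q @ post s"
      "subseq p \<alpha>" "subseq q \<beta>"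
      using o1 by blast
    ultimately show ?thesis using assms(3)
      by (intro exI[of _ "fresh p"] exI[of _ "fresh q"]) (simp add: R_simps fill_def subseq_plug)
  qed
  moreover have "word (fill s) = fresh \<alpha> @ ren i # fresh \<beta>"
    using assms(3) by (simp add: fill_def w)
  ultimately show ?thesis unfolding scan_pivot_def by blast
qed

text \<open>\<open>g\<close> occurs only once in the order, so the pieces around it are merely
  renumbered, and on them \<open>fresh\<close> agrees with \<open>plug\<close> for any
  \<open>l2\<close>.\<close>

lemma plug_split:
  assumes "x < nprods P1" "order P1 x = a @ p @ g # q @ b"
  shows "plug m g l2 (order P1 x) = fresh a @ fresh p @ map sh l2 @ fresh q @ fresh b"
proof -
  have "g \<notin> set a \<union> set p \<union> set q \<union> set b" using order1(1)[OF assms(1)] assms(2) by auto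
  then show ?thesis unfolding assms(2) by (simp add: plug_avoiding)
qed

text \<open>The pivot call serves \<open>g\<close> in every branch, so any product from the branches
  of \<open>r\<close> may stand in its place, being a subsequence of the word of \<open>r\<close>
  because \<open>r\<close> has empty prefix and suffix. The rest of the window is still covered by
  \<alpha> and \<beta>.\<close>

lemma graft_properties:
  assumes s: "scan_ok P1 s" and w: "word s = \<alpha> @ g # \<beta>"
    and o1: "\<forall>x\<in>branches s. \<exists>p q. order P1 x = pre s @ p @ g # q @ post s \<and> subseq p \<alpha> \<and> subseq q \<beta>"
    and r: "scan_ok P2 r" "pre r = []" "post r = []"
  shows "scan_ok R (graft s \<alpha> \<beta> r)"
    and "scan_pivot P2 r j \<Longrightarrow> scan_pivot R (graft s \<alpha> \<beta> r) (sh j)"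
proof -
  have s': "branches s \<noteq> {}" "branches s \<subseteq> {..<nprods P1}" "set \<alpha> \<subseteq> {..<m}" "set \<beta> \<subseteq> {..<m}"
    using s w by (auto simp: scan_ok_def)
  have r': "branches r \<noteq> {}" "branches r \<subseteq> {..<k2}" "set (word r) \<subseteq> {..<n2}"
    using r by (auto simp: scan_ok_def)
  note p = pairs_ok[OF s'(1,2) r'(1,2)]
  have key: "\<exists>p q. order R x = pre (graft s \<alpha> \<beta> r) @ p @ map sh (order P2 (x mod k2)) @ q @ post (graft s \<alpha> \<beta> r)
      \<and> subseq p (fresh \<alpha>) \<and> subseq q (fresh \<beta>)" if x: "x \<in> branches (graft s \<alpha> \<beta> r)" for x
  proof -
    have x1: "x div k2 \<in> branches s" using x p by (auto simp: graft_def)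
    then obtain p q where pq: "order P1 (x div k2) = pre s @ p @ g # q @ post s"
      "subseq p \<alpha>" "subseq q \<beta>"
      using o1 by blast
    have "order R x = fresh (pre s) @ fresh p @ map sh (order P2 (x mod k2)) @ fresh q @ fresh (post s)"
      unfolding R_simps by (rule plug_split[OF _ pq(1)]) (use x1 s' in auto)
    then show ?thesis using pq subseq_plug
      by (intro exI[of _ "fresh p"] exI[of _ "fresh q"]) (simp add: graft_def)
  qed
  have x2: "x mod k2 \<in> branches r" if "x \<in> branches (graft s \<alpha> \<beta> r)" for x
    using that p by (auto simp: graft_def)
  have "\<exists>q. order R x = pre (graft s \<alpha> \<beta> r) @ q @ post (graft s \<alpha> \<beta> r) \<and> subseq q (word (graft s \<alpha> \<beta> r))"
    if x: "x \<in> branches (graft s \<alpha> \<beta> r)" for x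
  proof -
    obtain p q where pq: "order R x = pre (graft s \<alpha> \<beta> r) @ p @ map sh (order P2 (x mod k2)) @ q @ post (graft s \<alpha> \<beta> r)"
      "subseq p (fresh \<alpha>)" "subseq q (fresh \<beta>)"
      using key[OF x] by blast
    have "subseq (order P2 (x mod k2)) (word r)"
      using r x2[OF x] by (auto simp: scan_ok_def)
    then have "subseq (p @ map sh (order P2 (x mod k2)) @ q) (word (graft s \<alpha> \<beta> r))"
      using pq by (auto simp: graft_def intro!: list_emb_append_mono subseq_map)
    then show ?thesis using pq(1) by (intro exI conjI) (auto simp: append_assoc)
  qed
  moreover have "set (word (graft s \<alpha> \<beta> r)) \<subseteq> {..<ngates R}"
    using set_fresh[OF s'(3)] set_fresh[OF s'(4)] r'(3) g by (auto simp: graft_def R_simps(1))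
  ultimately show "scan_ok R (graft s \<alpha> \<beta> r)"
    using p unfolding scan_ok_def by (auto simp: graft_def)
  assume "scan_pivot P2 r j"
  then obtain \<alpha>2 \<beta>2 where w2: "word r = \<alpha>2 @ j # \<beta>2"
    and o2: "\<forall>x\<in>branches r. \<exists>p q. order P2 x = p @ j # q \<and> subseq p \<alpha>2 \<and> subseq q \<beta>2"
    using r by (auto simp: scan_pivot_def)
  have "\<exists>p q. order R x = pre (graft s \<alpha> \<beta> r) @ p @ sh j # q @ post (graft s \<alpha> \<beta> r) \<and>
     subseq p (fresh \<alpha> @ map sh \<alpha>2) \<and> subseq q (map sh \<beta>2 @ fresh \<beta>)"
    if x: "x \<in> branches (graft s \<alpha> \<beta> r)" for x
  proof -
    obtain p q where pq: "order R x = pre (graft s \<alpha> \<beta> r) @ p @ map sh (order P2 (x mod k2)) @ q @ post (graft s \<alpha> \<beta> r)"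
      "subseq p (fresh \<alpha>)" "subseq q (fresh \<beta>)"
      using key[OF x] by blast
    obtain p2 q2 where pq2: "order P2 (x mod k2) = p2 @ j # q2" "subseq p2 \<alpha>2" "subseq q2 \<beta>2"
      using o2 x2[OF x] by blast
    show ?thesis using pq pq2
      by (intro exI[of _ "p @ map sh p2"] exI[of _ "map sh q2 @ q"])
         (auto intro!: list_emb_append_mono subseq_map)
  qed
  moreover have "word (graft s \<alpha> \<beta> r) = (fresh \<alpha> @ map sh \<alpha>2) @ sh j # (map sh \<beta>2 @ fresh \<beta>)"
    by (simp add: graft_def w2)
  ultimately show "scan_pivot R (graft s \<alpha> \<beta> r) (sh j)" unfolding scan_pivot_def by blast
qed

lemma lift_properties:
  assumes o1: "order P1 0 = p0 @ g # q0" and s: "scan_ok P2 s"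
  shows "scan_ok R (lift p0 q0 s)"
    and "scan_pivot P2 s j \<Longrightarrow> scan_pivot R (lift p0 q0 s) (sh j)"
proof -
  have s': "branches s \<noteq> {}" "branches s \<subseteq> {..<k2}" "set (word s) \<subseteq> {..<n2}"
    using s by (auto simp: scan_ok_def)
  note p = pairs_ok[of "{0}", OF _ _ s'(1,2)]
  have key: "order R x = fresh p0 @ map sh (order P2 (x mod k2)) @ fresh q0" "x mod k2 \<in> branches s"
    if x: "x \<in> branches (lift p0 q0 s)" for x
  proof -
    have x: "x div k2 = 0" "x mod k2 \<in> branches s" using x p k1_pos by (auto simp: lift_def)
    then show "order R x = fresh p0 @ map sh (order P2 (x mod k2)) @ fresh q0"
      using plug_split[OF k1_pos, of "[]" p0 q0 "[]"] o1 by (simp add: R_simps(3))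
    show "x mod k2 \<in> branches s" by (rule x)
  qed
  have "\<exists>q. order R x = pre (lift p0 q0 s) @ q @ post (lift p0 q0 s) \<and> subseq q (word (lift p0 q0 s))"
    if x: "x \<in> branches (lift p0 q0 s)" for x
  proof -
    obtain q where "order P2 (x mod k2) = pre s @ q @ post s" "subseq q (word s)"
      using s key(2)[OF x] by (auto simp: scan_ok_def)
    then show ?thesis using key(1)[OF x]
      by (intro exI[of _ "map sh q"]) (simp add: lift_def subseq_map)
  qed
  moreover have "set (word (lift p0 q0 s)) \<subseteq> {..<ngates R}"
    using s'(3) g by (auto simp: lift_def R_simps(1))
  ultimately show "scan_ok R (lift p0 q0 s)"
    using p k1_pos unfolding scan_ok_def by (auto simp: lift_def)
  assume "scan_pivot P2 s j"
  then obtain \<alpha>2 \<beta>2 where w2: "word s = \<alpha>2 @ j # \<beta>2"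
    and o2: "\<forall>x\<in>branches s. \<exists>p q. order P2 x = pre s @ p @ j # q @ post s \<and> subseq p \<alpha>2 \<and> subseq q \<beta>2"
    by (auto simp: scan_pivot_def)
  have "\<exists>p q. order R x = pre (lift p0 q0 s) @ p @ sh j # q @ post (lift p0 q0 s) \<and>
     subseq p (map sh \<alpha>2) \<and> subseq q (map sh \<beta>2)"
    if x: "x \<in> branches (lift p0 q0 s)" for x
  proof -
    obtain p q where "order P2 (x mod k2) = pre s @ p @ j # q @ post s" "subseq p \<alpha>2" "subseq q \<beta>2"
      using o2 key(2)[OF x] by blast
    then show ?thesis using key(1)[OF x]
      by (intro exI[of _ "map sh p"] exI[of _ "map sh q"]) (simp add: lift_def subseq_map)
  qed
  moreover have "word (lift p0 q0 s) = map sh \<alpha>2 @ sh j # map sh \<beta>2"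
    by (simp add: lift_def w2)
  ultimately show "scan_pivot R (lift p0 q0 s) (sh j)" unfolding scan_pivot_def by blast
qed

lemma sum_sign_pairs:
  assumes "Y \<subseteq> {..<k2}"
  shows "(\<Sum>x\<in>pairs k2 X Y. hsign R x y * hsign R x y')
     = (\<Sum>x\<in>X. hsign P1 x (y div k2) * hsign P1 x (y' div k2))
     * (\<Sum>x\<in>Y. hsign P2 x (y mod k2) * hsign P2 x (y' mod k2))"
  unfolding sum_pairs[OF assms, symmetric] by (intro sum.cong refl) (simp add: R_simps mult_ac)

text \<open>Product 0 of \<open>P2\<close> calls each of its gates once, so substituting it for
  \<open>g\<close> amounts to giving \<open>g\<close> the total weight of \<open>P2\<close>.\<close>

lemma cost_fresh:
  "cost \<omega> (fresh l) = cost (\<lambda>i. if i = g then \<Sum>j<n2. \<omega> (sh j) else \<omega> (ren i)) l"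
proof -
  have "cost (\<lambda>j. \<omega> (m - 1 + j)) (order P2 0) = (\<Sum>j<n2. \<omega> (sh j))"
    using order2[of 0] k2_pos by (simp add: cost_def sum_list_distinct_conv_sum_set)
  then show ?thesis by (simp only: cost_plug)
qed

text \<open>The scan with the pivot of \<open>g\<close> is grafted with the first scan
  \<open>r\<close> of \<open>P2\<close>; the other scans of \<open>P1\<close> are filled and those
  of \<open>P2\<close> lifted. Grafting trades one call of \<open>g\<close>, priced at the total
  weight of \<open>P2\<close>, for the word of \<open>r\<close>, which accounts for the extra sum on
  the left.\<close>

lemma plan_compose:
  assumes p1: "plan P1 es1" and p2: "plan P2 es2"
  shows "\<exists>es. plan R es \<and> total_cost \<omega> es + (\<Sum>j<n2. \<omega> (sh j))
     = total_cost (\<lambda>i. if i = g then \<Sum>j<n2. \<omega> (sh j) else \<omega> (ren i)) es1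
       + total_cost (\<lambda>j. \<omega> (sh j)) es2"
proof -
  obtain idx1 where idx1: "inj_on idx1 {..<m}" "\<And>i. i < m \<Longrightarrow> idx1 i < length es1"
    "\<And>i. i < m \<Longrightarrow> scan_pivot P1 (es1 ! idx1 i) i"
    using p1 by (auto simp: plan_def)
  obtain idx2 where idx2: "inj_on idx2 {..<n2}" "\<And>i. i < n2 \<Longrightarrow> idx2 i < length es2"
    "\<And>i. i < n2 \<Longrightarrow> scan_pivot P2 (es2 ! idx2 i) i"
    using p2 by (auto simp: plan_def)
  have ok1: "scan_ok P1 s" if "s \<in> set es1" for s using p1 that by (auto simp: plan_def)
  have ok2: "scan_ok P2 s" if "s \<in> set es2" for s using p2 that by (auto simp: plan_def)
  obtain r rs where es2: "es2 = r # rs" using p2 by (auto simp: plan_def neq_Nil_conv)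
  have r: "pre r = []" "post r = []" "scan_ok P2 r" using p2 by (auto simp: plan_def es2)
  define N where "N = length es1"
  define ig where "ig = idx1 g"
  have ig: "ig < N" using idx1(2) g by (simp add: ig_def N_def)
  define s0 where "s0 = es1 ! ig"
  have s0: "scan_ok P1 s0" using ok1 ig by (auto simp: s0_def N_def)
  obtain \<alpha> \<beta> where w0: "word s0 = \<alpha> @ g # \<beta>"
    and o0: "\<forall>x\<in>branches s0. \<exists>p q. order P1 x = pre s0 @ p @ g # q @ post s0 \<and> subseq p \<alpha> \<and> subseq q \<beta>"
    using idx1(3)[OF g] by (auto simp: scan_pivot_def s0_def ig_def)
  obtain p0 q0 where pq0: "order P1 0 = p0 @ g # q0"
    using order1(2)[OF k1_pos] g split_list[of g "order P1 0"] by auto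
  define G where "G = graft s0 \<alpha> \<beta> r"
  note G = graft_properties[OF s0 w0 o0 r(3,1,2), folded G_def]
  note lift = lift_properties[OF pq0]
  define es where "es = (map fill es1)[ig := G] @ map (lift p0 q0) rs"
  have es_nth1: "es ! e = (if e = ig then G else fill (es1 ! e))" if "e < N" for e
    using that ig by (simp add: es_def nth_append N_def)
  have es_nth2: "es ! (N + e) = lift p0 q0 (rs ! e)" if "e < length rs" for e
    using that by (simp add: es_def nth_append N_def)
  have len: "length es = N + length rs" by (simp add: es_def N_def)
  have b1: "branches s \<subseteq> {..<nprods P1}" "branches s \<noteq> {}" if "s \<in> set es1" for s
    using ok1[OF that] by (auto simp: scan_ok_def)
  have b2: "branches s \<subseteq> {..<k2}" "branches s \<noteq> {}" if "s \<in> set es2" for s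
    using ok2[OF that] by (auto simp: scan_ok_def)

  have "\<forall>s\<in>set es. scan_ok R s"
  proof -
    have "set es \<subseteq> insert G (fill ` set es1) \<union> lift p0 q0 ` set rs"
      using set_update_subset_insert[of "map fill es1" ig G] by (auto simp: es_def)
    then show ?thesis using G(1) fill_ok ok1 lift(1) ok2 by (auto simp: es2)
  qed
  moreover have "pre (hd es) = [] \<and> post (hd es) = []"
  proof -
    have N: "0 < N" using ig by simp
    have "hd es = es ! 0" using N len by (intro hd_conv_nth) auto
    moreover have "pre (es1 ! 0) = []" "post (es1 ! 0) = []"
      using p1 by (auto simp: plan_def hd_conv_nth)
    ultimately show ?thesis
      using es_nth1[OF N] by (auto simp: G_def graft_def fill_def s0_def)
  qed
  moreover have "separates R (set es)"
    unfolding separates_def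
  proof (intro allI impI)
    fix y y' assume y: "y < nprods R" "y' < nprods R" and ne: "y \<noteq> y'"
    let ?S1 = "\<lambda>X. \<Sum>x\<in>X. hsign P1 x (y div k2) * hsign P1 x (y' div k2)"
    let ?S2 = "\<lambda>X. \<Sum>x\<in>X. hsign P2 x (y mod k2) * hsign P2 x (y' mod k2)"
    have Gsum: "(\<Sum>x\<in>branches G. hsign R x y * hsign R x y') = ?S1 (branches s0) * ?S2 (branches r)"
      unfolding G_def graft_def scan.simps by (rule sum_sign_pairs) (use b2 es2 in auto)
    have Gin: "G \<in> set es" using es_nth1[OF ig] ig len by (metis nth_mem trans_less_add1)
    show "\<exists>s\<in>set es. (\<Sum>x\<in>branches s. hsign R x y * hsign R x y') = 0"
    \<comment> \<open>Indices differing in the \<open>P1\<close> part are separated by the image of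
      a scan of \<open>P1\<close>, all others by the image of a scan of \<open>P2\<close>. The two
      scans merged in \<open>G\<close> both keep their effect, since its sum is the product of
      theirs.\<close>
    proof (cases "y div k2 = y' div k2")
      case False
      then obtain s where "s \<in> set es1" "?S1 (branches s) = 0"
        using p1 div_mod_less(1)[OF y(1)] div_mod_less(1)[OF y(2)] unfolding plan_def separates_def by blast
      then obtain e where e: "e < N" "?S1 (branches (es1 ! e)) = 0" by (auto simp: in_set_conv_nth N_def)
      show ?thesis
      proof (cases "e = ig")
        case True
        then show ?thesis using e(2) Gin Gsum by (auto simp: s0_def)
      next
        case False
        have "(\<Sum>x\<in>branches (fill (es1 ! e)). hsign R x y * hsign R x y') = ?S1 (branches (es1 ! e)) * ?S2 {0}"
          unfolding fill_def scan.simps by (rule sum_sign_pairs) (use k2_pos in auto)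
        moreover have "fill (es1 ! e) \<in> set es" using es_nth1[OF e(1)] False e len by (metis nth_mem trans_less_add1)
        ultimately show ?thesis using e(2) by auto
      qed
    next
      case True
      then have "y mod k2 \<noteq> y' mod k2" using ne by (metis div_mult_mod_eq)
      then obtain s where s: "s \<in> set es2" "?S2 (branches s) = 0"
        using p2 div_mod_less(2) unfolding plan_def separates_def by blast
      show ?thesis
      proof (cases "s = r")
        case True
        then show ?thesis using s(2) Gin Gsum by auto
      next
        case False
        have "(\<Sum>x\<in>branches (lift p0 q0 s). hsign R x y * hsign R x y') = ?S1 {0} * ?S2 (branches s)"
          unfolding lift_def scan.simps by (rule sum_sign_pairs) (use b2 s in auto)
        moreover have "lift p0 q0 s \<in> set es" using False s(1) by (auto simp: es2 es_def)
        ultimately show ?thesis using s(2) by auto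
      qed
    qed
  qed
  moreover have "\<exists>idx. inj_on idx {..<ngates R} \<and>
      (\<forall>i<ngates R. idx i < length es \<and> scan_pivot R (es ! idx i) i)"
  proof -
    define u where "u i = (if i < g then i else i + 1)" for i
    \<comment> \<open>Position 0 of \<open>es2\<close> has become the graft at position
      \<open>ig\<close>; the later ones follow the \<open>N\<close> scans that come from
      \<open>es1\<close>, hence the shift by one.\<close>
    define t where "t j = (if idx2 j = 0 then ig else N + (idx2 j - 1))" for j
    define idx where "idx i = (if i < m - 1 then idx1 (u i) else t (i - (m - 1)))" for i
    have u: "u i < m" "u i \<noteq> g" "ren (u i) = i" if "i < m - 1" for i
    proof -
      have "i + 1 < m" using that by linarith
      then show "u i < m" "u i \<noteq> g" "ren (u i) = i" by (simp_all add: u_def)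
    qed
    \<comment> \<open>Injectivity of \<open>idx1\<close> keeps position \<open>ig\<close> free of
      the other gates of \<open>P1\<close>, so it can serve a gate of \<open>P2\<close>.\<close>
    have u_lt: "idx1 (u i) < N" "idx1 (u i) \<noteq> ig" if "i < m - 1" for i
      using idx1(2)[OF u(1)[OF that]] inj_onD[OF idx1(1), of "u i" g] u[OF that] g
      by (auto simp: N_def ig_def)
    have t_ge: "t j = ig \<or> N \<le> t j" for j by (auto simp: t_def)
    have t_inj: "j = j'" if "t j = t j'" "j < n2" "j' < n2" for j j'
    proof -
      have "idx2 j = idx2 j'" using that(1) ig by (auto simp: t_def split: if_splits)
      then show ?thesis using inj_onD[OF idx2(1)] that by auto
    qed
    have "inj_on idx {..<ngates R}"
    proof (rule inj_onI)
      fix i i' assume "i \<in> {..<ngates R}" "i' \<in> {..<ngates R}" and eq: "idx i = idx i'"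
      then have i: "i < m + n2 - 1" "i' < m + n2 - 1" by (auto simp: R_simps)
      consider "i < m - 1" "i' < m - 1" | "i < m - 1" "\<not> i' < m - 1" | "\<not> i < m - 1" "i' < m - 1"
        | "\<not> i < m - 1" "\<not> i' < m - 1" by blast
      then show "i = i'"
      proof cases
        case 1
        then have "u i = u i'" using eq inj_onD[OF idx1(1)] u by (auto simp: idx_def)
        then show ?thesis using u(3) 1 by metis
      next
        case 2
        then show ?thesis using eq u_lt[of i] t_ge[of "i' - (m - 1)"] by (auto simp: idx_def)
      next
        case 3
        then show ?thesis using eq u_lt[of i'] t_ge[of "i - (m - 1)"] by (auto simp: idx_def)
      next
        case 4
        have lt: "i - (m - 1) < n2" "i' - (m - 1) < n2" using i 4 by linarith+
        have "t (i - (m - 1)) = t (i' - (m - 1))" using eq 4 by (simp add: idx_def)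
        from t_inj[OF this lt] have "i - (m - 1) = i' - (m - 1)" .
        then show ?thesis using 4 by linarith
      qed
    qed
    moreover have "idx i < length es \<and> scan_pivot R (es ! idx i) i" if "i < ngates R" for i
    proof (cases "i < m - 1")
      case True
      have "scan_pivot R (fill (es1 ! idx1 (u i))) (ren (u i))"
        using u[OF True] idx1 ok1 by (intro fill_pivot) auto
      then show ?thesis using u_lt[OF True] u(3)[OF True] True by (simp add: idx_def es_nth1 len)
    next
      case False
      define j where "j = i - (m - 1)"
      have j: "j < n2" "i = sh j" using that False g by (auto simp: j_def R_simps)
      have piv: "scan_pivot P2 (es2 ! idx2 j) j" "idx2 j < length es2" using idx2 j by auto
      have idx_i: "idx i = t j" using False by (simp add: idx_def j_def)
      show ?thesis
      proof (cases "idx2 j")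
        case 0
        then show ?thesis using piv G(2)[of j] ig unfolding idx_i
          by (simp add: t_def es_nth1 len j es2)
      next
        case (Suc k)
        then have "scan_ok P2 (rs ! k)" "scan_pivot P2 (rs ! k) j" "k < length rs"
          using piv ok2 by (auto simp: es2)
        then show ?thesis using lift(2) Suc unfolding idx_i by (simp add: t_def es_nth2 len j)
      qed
    qed
    ultimately show ?thesis by blast
  qed
  moreover have "es \<noteq> []" using len ig by auto
  ultimately have "plan R es" unfolding plan_def by blast
  moreover
  let ?\<omega>1 = "\<lambda>i. if i = g then \<Sum>j<n2. \<omega> (sh j) else \<omega> (ren i)"
  have "total_cost \<omega> es + (\<Sum>j<n2. \<omega> (sh j)) = total_cost ?\<omega>1 es1 + total_cost (\<lambda>j. \<omega> (sh j)) es2"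
  proof -
    have sh: "cost \<omega> (map sh l) = cost (\<lambda>j. \<omega> (sh j)) l" for l by (simp add: cost_def o_def)
    have fill: "map (\<lambda>s. cost \<omega> (word (fill s))) es1 = map (\<lambda>s. cost ?\<omega>1 (word s)) es1"
      by (simp add: fill_def cost_fresh)
    define L where "L = map (\<lambda>s. cost ?\<omega>1 (word s)) es1"
    have "map (\<lambda>s. cost \<omega> (word s)) ((map fill es1)[ig := G]) = L[ig := cost \<omega> (word G)]"
      by (simp add: map_update o_def fill L_def)
    moreover have "sum_list (L[ig := c]) + L ! ig = sum_list L + c" for c
      using ig member_le_sum_list[of "L ! ig" L] by (simp add: sum_list_update L_def N_def)
    moreover have "L ! ig = cost ?\<omega>1 (word s0)" using ig by (simp add: L_def s0_def N_def)
    moreover have "total_cost ?\<omega>1 es1 = sum_list L" by (simp add: total_cost_def L_def)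
    ultimately have "(\<Sum>s\<leftarrow>(map fill es1)[ig := G]. cost \<omega> (word s)) + cost ?\<omega>1 (word s0)
        = total_cost ?\<omega>1 es1 + cost \<omega> (word G)" by metis
    moreover have "cost \<omega> (word G) + (\<Sum>j<n2. \<omega> (sh j)) = cost ?\<omega>1 (word s0) + cost (\<lambda>j. \<omega> (sh j)) (word r)"
      unfolding w0 by (simp add: G_def graft_def cost_fresh sh del: One_nat_def)
    moreover have "(\<Sum>s\<leftarrow>rs. cost \<omega> (word (lift p0 q0 s))) = total_cost (\<lambda>j. \<omega> (sh j)) rs"
      by (simp add: lift_def sh total_cost_def del: One_nat_def)
    moreover have "total_cost (\<lambda>j. \<omega> (sh j)) es2 = cost (\<lambda>j. \<omega> (sh j)) (word r) + total_cost (\<lambda>j. \<omega> (sh j)) rs"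
      by (simp add: es2 total_cost_def)
    moreover have "total_cost \<omega> es = (\<Sum>s\<leftarrow>(map fill es1)[ig := G]. cost \<omega> (word s))
        + (\<Sum>s\<leftarrow>rs. cost \<omega> (word (lift p0 q0 s)))"
      by (simp add: total_cost_def es_def o_def)
    ultimately show ?thesis by linarith
  qed
  ultimately show ?thesis by blast
qed

end


section \<open>The entropy bound\<close>

definition xlog :: "nat \<Rightarrow> real" where
  "xlog k = real k * log 2 (real k)"

definition pos :: "nat \<Rightarrow> real" where
  "pos k = (if k = 0 then 0 else 1)"

text \<open>The correction by the number of gates of positive weight also obeys a chain rule. For unit
  weights it is 2 (n - 1) and absorbs the total weight n on the right.\<close>

definition cheap :: "real \<Rightarrow> hpp \<Rightarrow> bool" where
  "cheap C P \<longleftrightarrow> (\<forall>\<omega>. \<exists>es. plan P es \<and>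
     real (total_cost \<omega> es) + 2 * ((\<Sum>i<ngates P. pos (\<omega> i)) - pos (\<Sum>i<ngates P. \<omega> i))
       \<le> C * (xlog (\<Sum>i<ngates P. \<omega> i) - (\<Sum>i<ngates P. xlog (\<omega> i))) + real (\<Sum>i<ngates P. \<omega> i))"

section \<open>Chain rules under composition\<close>

context composition
begin

text \<open>The gate \<open>g\<close>, given weight \<open>W\<close>, is traded for the gates of
  \<open>P2\<close>. Taking \<open>real\<close>, \<open>pos\<close> and \<open>xlog\<close> for
  \<open>F\<close> gives the chain rules for the total weight, the correction and the
  entropy.\<close>

lemma sum_gates_compose:
  fixes F :: "nat \<Rightarrow> real"
  shows "(\<Sum>i<ngates R. F (\<omega> i)) + F W
    = (\<Sum>i<m. F (if i = g then W else \<omega> (ren i))) + (\<Sum>j<n2. F (\<omega> (sh j)))"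
proof -
  have split: "(\<Sum>i<a + b. f i) = (\<Sum>i<a. f i) + (\<Sum>j<b. f (a + j))" for a b and f :: "nat \<Rightarrow> real"
    by (induction b) (simp_all add: add.assoc)
  have "(\<Sum>i<ngates R. F (\<omega> i)) = (\<Sum>i<m - 1 + n2. F (\<omega> i))"
    using g by (simp add: R_simps(1))
  also have "\<dots> = (\<Sum>i<m - 1. F (\<omega> i)) + (\<Sum>j<n2. F (\<omega> (sh j)))" by (rule split)
  also have "(\<Sum>i<m - 1. F (\<omega> i)) = (\<Sum>i\<in>{..<m} - {g}. F (\<omega> (ren i)))"
  proof (rule sum.reindex_bij_witness[of _ ren "\<lambda>i. if i < g then i else i + 1"])
    fix i assume "i \<in> {..<m - 1}"
    then have "i + 1 < m" by simp
    then show "(if i < g then i else i + 1) \<in> {..<m} - {g}" by simp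
  qed (use g in auto)
  also have "\<dots> = (\<Sum>i\<in>{..<m} - {g}. F (if i = g then W else \<omega> (ren i)))"
    by (intro sum.cong) auto
  also have "\<dots> = (\<Sum>i<m. F (if i = g then W else \<omega> (ren i))) - F W"
    using g by (subst sum_diff1) auto
  finally show ?thesis by simp
qed

text \<open>\<open>P1\<close> is planned with the total weight \<open>W\<close> of \<open>P2\<close>
  at \<open>g\<close>. The term \<open>xlog W\<close> enters the entropies of \<open>P1\<close> and
  \<open>P2\<close> with opposite signs, and \<open>pos W\<close> the corrections, so both add up to
  those of the composite. The call saved by grafting pays for the summand \<open>W\<close> in the
  bound for \<open>P2\<close>.\<close>

lemma cheap_compose:
  assumes "cheap C P1" "cheap C P2"
  shows "cheap C R"
  unfolding cheap_def
proof (intro allI)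
  fix \<omega> :: "nat \<Rightarrow> nat"
  define \<omega>2 where "\<omega>2 = (\<lambda>j. \<omega> (sh j))"
  define W where "W = (\<Sum>j<n2. \<omega>2 j)"
  define \<omega>1 where "\<omega>1 = (\<lambda>i. if i = g then W else \<omega> (ren i))"
  obtain es1 where es1: "plan P1 es1"
    "real (total_cost \<omega>1 es1) + 2 * ((\<Sum>i<m. pos (\<omega>1 i)) - pos (\<Sum>i<m. \<omega>1 i))
       \<le> C * (xlog (\<Sum>i<m. \<omega>1 i) - (\<Sum>i<m. xlog (\<omega>1 i))) + real (\<Sum>i<m. \<omega>1 i)"
    using assms(1) unfolding cheap_def by blast
  obtain es2 where es2: "plan P2 es2"
    "real (total_cost \<omega>2 es2) + 2 * ((\<Sum>i<n2. pos (\<omega>2 i)) - pos W)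
       \<le> C * (xlog W - (\<Sum>i<n2. xlog (\<omega>2 i))) + real W"
    using assms(2) unfolding cheap_def W_def by blast
  obtain es where es: "plan R es" "total_cost \<omega> es + W = total_cost \<omega>1 es1 + total_cost \<omega>2 es2"
    using plan_compose[OF es1(1) es2(1), of \<omega>] unfolding \<omega>1_def \<omega>2_def W_def by blast
  have S0: "(\<Sum>i<ngates R. \<omega> i) = (\<Sum>i<m. \<omega>1 i)"
  proof -
    have "(\<Sum>i<ngates R. real (\<omega> i)) + real W = (\<Sum>i<m. real (\<omega>1 i)) + (\<Sum>j<n2. real (\<omega>2 j))"
      unfolding \<omega>2_def \<omega>1_def by (rule sum_gates_compose)
    then have "real (\<Sum>i<ngates R. \<omega> i) = real (\<Sum>i<m. \<omega>1 i)" by (simp add: W_def)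
    then show ?thesis by (simp only: of_nat_eq_iff)
  qed
  have S1: "(\<Sum>i<ngates R. pos (\<omega> i)) + pos W = (\<Sum>i<m. pos (\<omega>1 i)) + (\<Sum>j<n2. pos (\<omega>2 j))"
    unfolding \<omega>2_def \<omega>1_def by (rule sum_gates_compose)
  have S2: "(\<Sum>i<ngates R. xlog (\<omega> i)) + xlog W = (\<Sum>i<m. xlog (\<omega>1 i)) + (\<Sum>j<n2. xlog (\<omega>2 j))"
    unfolding \<omega>2_def \<omega>1_def by (rule sum_gates_compose)
  have T: "real (total_cost \<omega> es) + real W = real (total_cost \<omega>1 es1) + real (total_cost \<omega>2 es2)"
    using es(2) by linarith
  have X: "C * (xlog (\<Sum>i<m. \<omega>1 i) - (\<Sum>i<ngates R. xlog (\<omega> i)))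
      = C * (xlog (\<Sum>i<m. \<omega>1 i) - (\<Sum>i<m. xlog (\<omega>1 i))) + C * (xlog W - (\<Sum>i<n2. xlog (\<omega>2 i)))"
    unfolding distrib_left[symmetric] using S2 by (intro arg_cong[of _ _ "(*) C"]) linarith
  have arith: "t + 2 * (p - q) \<le> x + s"
    if "x = x1 + x2" "t1 + 2 * (p1 - q) \<le> x1 + s" "t2 + 2 * (p2 - q') \<le> x2 + w"
      "t + w = t1 + t2" "p + q' = p1 + p2" for t p q x s x1 x2 t1 t2 p1 p2 q' w :: real
    using that by simp
  have "real (total_cost \<omega> es) + 2 * ((\<Sum>i<ngates R. pos (\<omega> i)) - pos (\<Sum>i<m. \<omega>1 i))
       \<le> C * (xlog (\<Sum>i<m. \<omega>1 i) - (\<Sum>i<ngates R. xlog (\<omega> i))) + real (\<Sum>i<m. \<omega>1 i)"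
    by (rule arith[OF X es1(2) es2(2) T S1])
  then show "\<exists>es. plan R es \<and>
     real (total_cost \<omega> es) + 2 * ((\<Sum>i<ngates R. pos (\<omega> i)) - pos (\<Sum>i<ngates R. \<omega> i))
       \<le> C * (xlog (\<Sum>i<ngates R. \<omega> i) - (\<Sum>i<ngates R. xlog (\<omega> i))) + real (\<Sum>i<ngates R. \<omega> i)"
    unfolding S0 using es(1) by blast
qed

end

section \<open>Plans for single problems\<close>

lemma subseq_concat_replicate:
  "set l \<subseteq> set ls \<Longrightarrow> length l \<le> r \<Longrightarrow> subseq l (concat (replicate r ls))"
proof (induction l arbitrary: r)
  case (Cons x l)
  then obtain r' where r: "r = Suc r'" by (cases r) auto
  \<comment> \<open>The first copy of \<open>ls\<close> supplies \<open>x\<close>, the remaining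
    ones supply \<open>l\<close>.\<close>
  have "subseq ([x] @ l) (ls @ concat (replicate r' ls))"
    using Cons r by (intro list_emb_append_mono) (auto simp: subseq_singleton_left)
  then show ?case by (simp add: r)
qed simp

lemma cost_concat_replicate: "cost \<omega> (concat (replicate r ls)) = r * cost \<omega> ls"
  by (induction r) simp_all

text \<open>The first scan covers all products and holds the pivot of \<open>h\<close>. Every other
  gate gets a scan of product 0 whose window is the gate itself, which provides a pivot for later
  grafting. These single calls and the one call of \<open>h\<close> add up to the second sum of the
  cost.\<close>

lemma plan_base:
  assumes P: "wf_hpp P" and orth: "separates P {\<lparr>pre = [], branches = {..<nprods P}, word = [], post = []\<rparr>}"
    and h: "h < ngates P"
  shows "\<exists>es. plan P es \<and> total_cost \<omega> es =
     2 * (ngates P - 1) * (\<Sum>i\<in>{..<ngates P} - {h}. \<omega> i) + (\<Sum>i<ngates P. \<omega> i)"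
proof -
  define k where "k = ngates P"
  define ls where "ls = filter (\<lambda>i. i \<noteq> h) [0..<k]"
  define u where "u = concat (replicate (k - 1) ls)"
  define root where "root = \<lparr>pre = [], branches = {..<nprods P}, word = u @ h # u, post = []\<rparr>"
  have ls: "set ls = {..<k} - {h}" "distinct ls" by (auto simp: ls_def)
  have ord: "distinct (order P x)" "set (order P x) = {..<k}" if "x < nprods P" for x
    using P that by (auto simp: wf_hpp_def k_def)
  have P0: "0 < nprods P" using P by (simp add: wf_hpp_def)
  have root_split: "\<exists>p q. order P x = p @ h # q \<and> subseq p u \<and> subseq q u" if x: "x < nprods P" for x
  proof -
    obtain p q where pq: "order P x = p @ h # q"
      using split_list[of h "order P x"] ord(2)[OF x] h by (auto simp: k_def)
    have "length (order P x) = k" using ord[OF x] distinct_card[of "order P x"] by simp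
    \<comment> \<open>\<open>h\<close> takes one of the \<open>k\<close> places, so at most
      \<open>k - 1\<close> gates precede or follow it; this sets the number of rounds in
      \<open>u\<close>.\<close>
    then have len: "length p \<le> k - 1" "length q \<le> k - 1" unfolding pq by auto
    have "set (order P x) - {h} = set ls" unfolding ord(2)[OF x] ls by simp
    then have "set p \<subseteq> set ls" "set q \<subseteq> set ls" using ord(1)[OF x] unfolding pq by auto
    then show ?thesis using pq len unfolding u_def by (blast intro: subseq_concat_replicate)
  qed
  have "\<forall>i. \<exists>p q. i < k \<longrightarrow> order P 0 = p @ i # q"
    using ord(2)[OF P0] by (metis lessThan_iff split_list)
  then obtain a b where ab: "\<And>i. i < k \<Longrightarrow> order P 0 = a i @ i # b i" by metis
  define single where "single i = \<lparr>pre = a i, branches = {0}, word = [i], post = b i\<rparr>" for i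
  have single: "scan_ok P (single i)" "scan_pivot P (single i) i" if "i < k" for i
  proof -
    show "scan_ok P (single i)" using ab[OF that] P0 that
      by (auto simp: scan_ok_def single_def k_def intro!: exI[of _ "[i]"])
    show "scan_pivot P (single i) i" using ab[OF that]
      by (auto simp: scan_pivot_def single_def intro!: exI[of _ "[]"])
  qed
  have u_set: "set u \<subseteq> {..<k}" using ls by (auto simp: u_def)
  have root: "scan_ok P root" "scan_pivot P root h"
  proof -
    have "\<exists>q. order P x = q \<and> subseq q (u @ h # u)" if x: "x < nprods P" for x
    proof -
      obtain p q where pq: "order P x = p @ h # q" "subseq p u" "subseq q u"
        using root_split[OF x] by blast
      have "subseq (p @ h # q) (u @ h # u)" using pq by (intro list_emb_append_mono) auto
      then show ?thesis using pq(1) by simp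
    qed
    then show "scan_ok P root" using P0 u_set h by (auto simp: scan_ok_def root_def k_def)
    show "scan_pivot P root h" 
      unfolding scan_pivot_def by (intro exI[of _ u]) (use root_split in \<open>auto simp: root_def\<close>)
  qed
  define es where "es = root # map single ls"
  have "\<forall>i. \<exists>t. i \<in> set ls \<longrightarrow> t < length ls \<and> ls ! t = i" by (metis in_set_conv_nth)
  then obtain f where f: "\<And>i. i \<in> set ls \<Longrightarrow> f i < length ls \<and> ls ! f i = i" by metis
  define idx where "idx i = (if i = h then 0 else Suc (f i))" for i
  have "inj_on idx {..<k}"
  proof (rule inj_onI)
    fix i j assume "i \<in> {..<k}" "j \<in> {..<k}" and eq: "idx i = idx j"
    then have fi: "i \<noteq> h \<Longrightarrow> ls ! f i = i" "j \<noteq> h \<Longrightarrow> ls ! f j = j" using f ls by auto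
    show "i = j"
    proof (cases "i = h \<or> j = h")
      case True
      then show ?thesis using eq by (auto simp: idx_def split: if_splits)
    next
      case False
      then have "f i = f j" using eq by (simp add: idx_def)
      then show ?thesis using fi False by metis
    qed
  qed
  moreover have "idx i < length es \<and> scan_pivot P (es ! idx i) i" if "i < k" for i
  proof (cases "i = h")
    case True
    then show ?thesis using root by (simp add: idx_def es_def)
  next
    case False
    then have "i \<in> set ls" using that by (auto simp: ls)
    then show ?thesis using False f[of i] single[OF that] by (simp add: idx_def es_def)
  qed
  moreover have "separates P (set es)"
    using orth by (auto simp: separates_def es_def root_def)
  ultimately have "plan P es"
    using root single ls by (auto simp: plan_def es_def root_def k_def)
  moreover have "total_cost \<omega> es = 2 * (k - 1) * (\<Sum>i\<in>{..<k} - {h}. \<omega> i) + (\<Sum>i<k. \<omega> i)"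
  proof -
    have L: "cost \<omega> ls = (\<Sum>i\<in>{..<k} - {h}. \<omega> i)"
      using ls by (simp add: cost_def sum_list_distinct_conv_sum_set)
    have "total_cost \<omega> (map single ls) = cost \<omega> ls"
      by (simp add: total_cost_def single_def o_def cost_def)
    moreover have "total_cost \<omega> es = cost \<omega> (word root) + total_cost \<omega> (map single ls)"
      by (simp add: es_def total_cost_def)
    moreover have "cost \<omega> (word root) = 2 * ((k - 1) * cost \<omega> ls) + \<omega> h"
      by (simp add: root_def u_def cost_concat_replicate)
    moreover have "(\<Sum>i<k. \<omega> i) = \<omega> h + (\<Sum>i\<in>{..<k} - {h}. \<omega> i)"
      using h by (simp add: k_def sum.remove)
    ultimately show ?thesis unfolding L by simp
  qed
  ultimately show ?thesis unfolding k_def by blast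
qed

text \<open>By Bernoulli's inequality (1 + 1/a)^a is at least 2, and \<open>b\<close> is at least
  \<open>a + 1\<close>. Used to see that the heavy gate adds at least 1 to the entropy when another
  gate has positive weight.\<close>

lemma mult_log_growth:
  fixes a b :: nat
  assumes "1 \<le> a" "a < b"
  shows "1 \<le> real a * (log 2 (real b) - log 2 (real a))"
proof -
  have "2 \<le> 1 + real a * (1 / real a)" using assms by simp
  also have "\<dots> \<le> (1 + 1 / real a) ^ a"
    by (rule Bernoulli_inequality) (use assms in \<open>auto simp: field_simps\<close>)
  finally have "log 2 2 \<le> log 2 ((1 + 1 / real a) ^ a)"
    using assms by (subst log_le_cancel_iff) (auto intro: add_pos_pos)
  also have "\<dots> = real a * log 2 ((real a + 1) / real a)"
    using assms by (simp add: log_nat_power add_divide_distrib)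
  also have "log 2 ((real a + 1) / real a) = log 2 (real a + 1) - log 2 (real a)"
    using assms by (simp add: log_divide)
  also have "real a * (log 2 (real a + 1) - log 2 (real a)) \<le> real a * (log 2 (real b) - log 2 (real a))"
    using assms by (intro mult_left_mono) auto
  finally show ?thesis by simp
qed

text \<open>With total weight W, the entropy is the sum of the terms \<omega> i * log (W / \<omega>
  i). A light gate has at most half of W, so its term is at least \<omega> i. The heavy term is at
  least 1 unless all light weights vanish, and multiplied by \<open>C\<close> this 1 covers the
  correction, which is at most 2 (k - 1).\<close>

lemma heavy_gate_bound:
  fixes \<omega> :: "nat \<Rightarrow> nat" and C :: real
  assumes h: "h < k" "\<And>i. i < k \<Longrightarrow> \<omega> i \<le> \<omega> h" and C: "2 * (real k - 1) \<le> C" "2 \<le> C"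
  shows "2 * (real k - 1) * real (\<Sum>i\<in>{..<k} - {h}. \<omega> i)
      + 2 * ((\<Sum>i<k. pos (\<omega> i)) - pos (\<Sum>i<k. \<omega> i))
    \<le> C * (xlog (\<Sum>i<k. \<omega> i) - (\<Sum>i<k. xlog (\<omega> i)))"
proof -
  let ?I = "{..<k} - {h}"
  define W where "W = (\<Sum>i<k. \<omega> i)"
  define L where "L = (\<Sum>i\<in>?I. \<omega> i)"
  have W: "W = \<omega> h + L" using h(1) by (simp add: W_def L_def sum.remove)
  have split: "(\<Sum>i<k. f i) = f h + (\<Sum>i\<in>?I. f i)" for f :: "nat \<Rightarrow> real"
    using h(1) by (simp add: sum.remove)
  let ?t = "\<lambda>i. real (\<omega> i) * (log 2 (real W) - log 2 (real (\<omega> i)))"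
  have "xlog W = (\<Sum>i<k. real (\<omega> i) * log 2 (real W))"
    by (simp add: xlog_def W_def sum_distrib_right)
  then have xl: "xlog W - (\<Sum>i<k. xlog (\<omega> i)) = ?t h + (\<Sum>i\<in>?I. ?t i)"
    unfolding split[of ?t, symmetric] by (simp add: xlog_def sum_subtractf right_diff_distrib)
  have light: "real (\<omega> i) \<le> ?t i" if i: "i \<in> ?I" for i
  proof (cases "\<omega> i = 0")
    case False
    have "\<omega> i \<le> L" unfolding L_def by (rule member_le_sum) (use i in auto)
    then have "2 * \<omega> i \<le> W" using h(2)[of i] i W by auto
    then have "log 2 (2 * real (\<omega> i)) \<le> log 2 (real W)" using False by (subst log_le_cancel_iff) auto
    then have "1 \<le> log 2 (real W) - log 2 (real (\<omega> i))" using False by (simp add: log_mult)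
    then show ?thesis using mult_left_mono[of 1 "log 2 (real W) - log 2 (real (\<omega> i))" "real (\<omega> i)"] by simp
  qed simp
  have lights: "real L \<le> (\<Sum>i\<in>?I. ?t i)"
    unfolding L_def of_nat_sum by (rule sum_mono) (rule light)
  show ?thesis
  \<comment> \<open>If all light weights vanish, entropy and correction are both 0. Otherwise
    \<open>\<omega> h < W\<close>, as \<open>mult_log_growth\<close> requires.\<close>
  proof (cases "L = 0")
    case True
    then have z: "\<omega> i = 0" if "i \<in> ?I" for i using that by (auto simp: L_def)
    have "(\<Sum>i<k. pos (\<omega> i)) = pos (\<omega> h)" unfolding split using z by (simp add: pos_def)
    moreover have "W = \<omega> h" using W True by simp
    moreover have "(\<Sum>i\<in>?I. ?t i) = 0" using z by simp
    ultimately show ?thesis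
      using True xl unfolding W_def[symmetric] L_def[symmetric] by simp
  next
    case False
    then obtain i where i: "i \<in> ?I" "0 < \<omega> i" unfolding L_def by (auto simp: sum_eq_0_iff)
    then have "1 \<le> \<omega> h" using h(2)[of i] by auto
    then have "1 \<le> ?t h" using False W by (intro mult_log_growth) auto
    then have "C * (real L + 1) \<le> C * (?t h + (\<Sum>i\<in>?I. ?t i))"
      using lights C by (intro mult_left_mono) auto
    moreover have "2 * (real k - 1) * (real L + 1) \<le> C * (real L + 1)"
      using C by (intro mult_right_mono) auto
    moreover have "(\<Sum>i<k. pos (\<omega> i)) \<le> (\<Sum>i<k. 1)" by (rule sum_mono) (simp add: pos_def)
    moreover have "pos W = 1" using False W by (simp add: pos_def)
    ultimately show ?thesis
      unfolding W_def[symmetric] L_def[symmetric] xl by (simp add: algebra_simps)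
  qed
qed

section \<open>The given problems and the final bound\<close>

lemma valid_hpp_wf: "valid_hpp P \<Longrightarrow> wf_hpp P"
  by (auto simp: valid_hpp_def wf_hpp_def)

text \<open>Orthogonality of the Hadamard columns says that the scan of all complete products
  separates. A gate of largest weight is taken as the heavy one.\<close>

lemma valid_hpp_cheap:
  assumes "valid_hpp P" and C: "2 * (real (ngates P) - 1) \<le> C" "2 \<le> C"
  shows "cheap C P"
  unfolding cheap_def
proof (intro allI)
  fix \<omega> :: "nat \<Rightarrow> nat"
  have P: "wf_hpp P" by (rule valid_hpp_wf[OF assms(1)])
  let ?s = "\<lparr>pre = [], branches = {..<nprods P}, word = [], post = []\<rparr>"
  have sep: "separates P {?s}" using assms(1) by (auto simp: separates_def valid_hpp_def)
  show "\<exists>es. plan P es \<and>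
     real (total_cost \<omega> es) + 2 * ((\<Sum>i<ngates P. pos (\<omega> i)) - pos (\<Sum>i<ngates P. \<omega> i))
       \<le> C * (xlog (\<Sum>i<ngates P. \<omega> i) - (\<Sum>i<ngates P. xlog (\<omega> i))) + real (\<Sum>i<ngates P. \<omega> i)"
  proof (cases "ngates P = 0")
    \<comment> \<open>Without gates there is no heavy one; all products are empty, and a single scan
      with empty word forms the plan.\<close>
    case True
    have "plan P [?s]" using sep P True 
      by (auto simp: plan_def scan_ok_def wf_hpp_def lessThan_empty_iff)
    then show ?thesis by (intro exI[of _ "[?s]"]) (simp add: True total_cost_def pos_def xlog_def)
  next
    case False
    obtain h where h: "h < ngates P" "\<And>i. i < ngates P \<Longrightarrow> \<omega> i \<le> \<omega> h"
    proof -
      have "Max (\<omega> ` {..<ngates P}) \<in> \<omega> ` {..<ngates P}" using False by (intro Max_in) auto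
      then obtain h where "h < ngates P" "\<omega> h = Max (\<omega> ` {..<ngates P})" by auto
      then show ?thesis using that by simp
    qed
    obtain es where es: "plan P es" "total_cost \<omega> es =
      2 * (ngates P - 1) * (\<Sum>i\<in>{..<ngates P} - {h}. \<omega> i) + (\<Sum>i<ngates P. \<omega> i)"
      using plan_base[OF P sep h(1)] by blast
    have "real (total_cost \<omega> es) = 2 * (real (ngates P) - 1) * real (\<Sum>i\<in>{..<ngates P} - {h}. \<omega> i)
        + real (\<Sum>i<ngates P. \<omega> i)"
      unfolding es(2) using h(1) by (simp add: of_nat_diff)
    then show ?thesis using heavy_gate_bound[of h "ngates P" \<omega> C] h C es(1)
      by (intro exI[of _ es] conjI) auto
  qed
qed

theorem mainTheorem2:
  fixes F :: "hpp set"
  assumes "finite F"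
    and "\<forall>P\<in>F. valid_hpp P"
  shows "\<forall>P\<in>hpp_class F. 2 \<le> ngates P \<longrightarrow>
           (\<forall>d\<ge>1. \<exists>Q. wf_alg (ngates P) d Q \<and> solves P d Q \<and>
              real (num_queries Q)
                \<le> (2 * (real (Max (ngates ` F)) - 1)) * real (ngates P) * log 2 (real (ngates P)))"
proof (intro ballI impI allI)
  fix P and d :: nat assume P: "P \<in> hpp_class F" and n: "2 \<le> ngates P" and d: "1 \<le> d"
  define K where "K = Max (ngates ` F)"
  define C where "C = 2 * (real K - 1)"
  have F_le: "ngates P' \<le> K" if "P' \<in> F" for P'
    unfolding K_def using assms(1) that by (intro Max_ge) auto
  \<comment> \<open>Composing problems with at most one gate never gives more than 1 + 1 - 1 gates.
    So two gates in \<open>P\<close> force \<open>2 \<le> K\<close> and hence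
    \<open>2 \<le> C\<close>, as \<open>valid_hpp_cheap\<close> requires.\<close>
  have "ngates P' \<le> 1" if "P' \<in> hpp_class F" "K \<le> 1" for P'
    using that(1)
  proof induction
    case (base P')
    then show ?case using F_le[OF base] that(2) by linarith
  next
    case (comp P1 P2 g)
    then show ?case by (auto simp: Defs.compose_def Let_def)
  qed
  from this[OF P] have K: "2 \<le> K" using n by (cases "K \<le> 1") auto
  have "wf_hpp P' \<and> cheap C P'" if "P' \<in> hpp_class F" for P'
    using that
  proof induction
    case (base P')
    then show ?case using assms(2) F_le[OF base] K
      by (auto simp: C_def valid_hpp_wf intro!: valid_hpp_cheap)
  next
    case (comp P1 P2 g)
    then interpret composition P1 P2 g by unfold_locales auto
    show ?case using comp wf_compose cheap_compose by auto
  qed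
  then have "wf_hpp P" "cheap C P" using P by auto
  then obtain es where es: "plan P es" "real (total_cost (\<lambda>_. 1) es)
      + 2 * ((\<Sum>i<ngates P. pos 1) - pos (\<Sum>i<ngates P. 1))
      \<le> C * (xlog (\<Sum>i<ngates P. 1) - (\<Sum>i<ngates P. xlog 1)) + real (\<Sum>i<ngates P. 1)"
    unfolding cheap_def by blast
  \<comment> \<open>For unit weights the entropy is n log n and the correction 2 (n - 1), which
    turns the summand n into 2 - n, at most 0 for n \<ge> 2.\<close>
  have "real (total_cost (\<lambda>_. 1) es) \<le> C * xlog (ngates P) - real (ngates P) + 2"
    using es(2) n by (simp add: pos_def xlog_def)
  moreover obtain Q where "wf_alg (ngates P) d Q" "solves P d Q"
    "num_queries Q = (\<Sum>s\<leftarrow>es. length (word s))"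
    using scans_solve[OF \<open>wf_hpp P\<close> d] es(1) unfolding plan_def by blast
  moreover have "total_cost (\<lambda>_. 1) es = (\<Sum>s\<leftarrow>es. length (word s))"
    by (simp add: total_cost_def cost_def sum_list_triv)
  ultimately show "\<exists>Q. wf_alg (ngates P) d Q \<and> solves P d Q \<and>
      real (num_queries Q) \<le> (2 * (real (Max (ngates ` F)) - 1)) * real (ngates P) * log 2 (real (ngates P))"
    using n by (intro exI[of _ Q] conjI) (auto simp: C_def K_def xlog_def mult.assoc)
qed

end
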